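(* Let $\Omega\subset\mathbb{R}^2$ be a curvilinear polygon, $s\in(0,1)$, let $A$ be analytic on $\overline\Omega$ in the sense of the bound (AN) of the context, symmetric and uniformly positive definite on $\Omega$, and let $\mathcal{L}w=-\operatorname{div}(A\nabla w)$ with homogeneous Dirichlet boundary conditions. Let $G\subset\mathbb{C}^2$ be an open set containing $\overline\Omega$ (with $\mathbb{R}^2\subset\mathbb{C}^2$), and let $\mathcal{A}\subset L^2(\Omega)$ be the set of functions $f:\Omega\to\mathbb{R}$ that admit a holomorphic extension to $G$ with $\|f\|_{L^\infty(G)}\le1$. Put $\mathcal{K}:=\mathcal{L}^{-s}\mathcal{A}\subset\mathbb{H}^s(\Omega)$. Then there are constants $C,b>0$ independent of $N$ such that the Kolmogorov $N$-widths satisfy $$d_N(\mathcal{K},\mathbb{H}^s(\Omega))\le C\exp(-bN^{1/4})\qquad\text{for all }N\in\mathbb{N}.$$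
   Context: **Domain.** A curvilinear polygon with $J$ vertices is a bounded Lipschitz domain $\Omega\subset\mathbb{R}^2$ whose boundary is a single closed curve $\overline{\Gamma_1}\cup\dots\cup\overline{\Gamma_J}$ with disjoint open arcs $\Gamma_j=\{\mathbf{x}_j(\theta):\theta\in(0,1)\}$, where $\mathbf{x}_j$ is real analytic on $[0,1]$ and $\min_{[0,1]}|\dot{\mathbf{x}}_j|^2>0$; vertices are $\mathbf{x}_j(0),\mathbf{x}_j(1)$, with interior angles in $(0,2\pi)$. **Coefficient.** (AN): there is $C_A>0$ with $\||D^pA|\|_{L^\infty(\Omega)}\le C_A^{p+1}p!$ for all $p\in\mathbb{N}_0$, where $|D^pA|=\sum_{|\alpha|=p}|D^\alpha A|$. **Fractional operator.** $(\lambda_k,\varphi_k)_{k\ge1}$ are the eigenpairs of $\mathcal{L}$ on $H^1_0(\Omega)$, with $(\varphi_k)$ an orthonormal basis of $L^2(\Omega)$. For $\sigma\ge0$, $\mathbb{H}^\sigma(\Omega)=\{v=\sum v_k\varphi_k:\|v\|^2_{\mathbb{H}^\sigma(\Omega)}=\sum\lambda_k^\sigma v_k^2<\infty\}$, and $\mathbb{H}^{-\sigma}(\Omega)$ is its dual. $\mathcal{L}^sv=\sum v_k\lambda_k^s\varphi_k$ is an isomorphism $\mathbb{H}^s(\Omega)\to\mathbb{H}^{-s}(\Omega)$ with inverse $\mathcal{L}^{-s}$. **$N$-width.** For a normed space $X$ and a compact $\mathcal{K}\subset X$, $d_N(\mathcal{K},X)=\inf_{E_N}\sup_{f\in\mathcal{K}}\inf_{g\in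 E_N}\|f-g\|_X$, where the first infimum is over all subspaces $E_N\subset X$ of dimension $N$. *)

theory Defs
  imports "HOL-Analysis.Analysis"
begin

section \<open>Curvilinear polygons\<close>

text \<open>Near each boundary point, in suitable orthonormal coordinates, the domain is the part of a
  rectangle lying strictly below the graph of a Lipschitz function.\<close>

definition bounded_Lipschitz_domain :: "(real^2) set \<Rightarrow> bool" where
  "bounded_Lipschitz_domain \<Omega> \<longleftrightarrow>
     \<Omega> \<noteq> {} \<and> open \<Omega> \<and> connected \<Omega> \<and> bounded \<Omega> \<and>
     (\<forall>p\<in>frontier \<Omega>. \<exists>e\<^sub>1 e\<^sub>2 r h L \<gamma>.
        norm e\<^sub>1 = 1 \<and> norm e\<^sub>2 = 1 \<and> e\<^sub>1 \<bullet> e\<^sub>2 = 0 \<and> 0 < r \<and> 0 < h \<and>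
        lipschitz_on L UNIV (\<gamma> :: real \<Rightarrow> real) \<and> (\<forall>t. \<bar>t\<bar> < r \<longrightarrow> \<bar>\<gamma> t\<bar> < h) \<and>
        (\<forall>y. \<bar>(y - p) \<bullet> e\<^sub>1\<bar> < r \<and> \<bar>(y - p) \<bullet> e\<^sub>2\<bar> < h \<longrightarrow>
             (y \<in> \<Omega> \<longleftrightarrow> (y - p) \<bullet> e\<^sub>2 < \<gamma> ((y - p) \<bullet> e\<^sub>1))))"

definition real_analytic_curve :: "(real \<Rightarrow> real^2) \<Rightarrow> bool" where
  "real_analytic_curve x \<longleftrightarrow>
     (\<forall>t\<in>{0..1}. \<exists>r>0. \<exists>c :: nat \<Rightarrow> real^2. \<forall>u\<in>{0..1}.
        \<bar>u - t\<bar> < r \<longrightarrow> (\<lambda>n. (u - t) ^ n *\<^sub>R c n) sums x u)"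

abbreviation velocity :: "(real \<Rightarrow> real^2) \<Rightarrow> real \<Rightarrow> real^2" where
  "velocity x t \<equiv> vector_derivative x (at t within {0..1})"

definition rotate2 :: "real \<Rightarrow> real^2 \<Rightarrow> real^2" where
  "rotate2 \<alpha> u = vector [cos \<alpha> * u$1 - sin \<alpha> * u$2, sin \<alpha> * u$1 + cos \<alpha> * u$2]"

text \<open>At the boundary point \<open>p\<close>, with boundary rays leaving in the directions \<open>u\<close> and \<open>v\<close>, the
  sector swept when \<open>u\<close> is turned through the angle \<open>\<omega>\<close> onto \<open>v\<close> (counterclockwise for
  \<open>\<sigma> = 1\<close>, clockwise for \<open>\<sigma> = -1\<close>) is the one occupied by the domain near \<open>p\<close>.\<close>

definition has_interior_angle ::
    "(real^2) set \<Rightarrow> real^2 \<Rightarrow> real^2 \<Rightarrow> real^2 \<Rightarrow> real \<Rightarrow> bool" where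
  "has_interior_angle \<Omega> p u v \<omega> \<longleftrightarrow>
     (\<exists>\<sigma>\<in>{1, -1}.
        v /\<^sub>R norm v = rotate2 (\<sigma> * \<omega>) (u /\<^sub>R norm u) \<and>
        (\<forall>\<alpha>\<in>{0<..<\<omega>}. \<forall>\<^sub>F t in at_right 0. p + t *\<^sub>R rotate2 (\<sigma> * \<alpha>) u \<in> \<Omega>) \<and>
        (\<forall>\<alpha>\<in>{\<omega><..<2 * pi}. \<forall>\<^sub>F t in at_right 0. p + t *\<^sub>R rotate2 (\<sigma> * \<alpha>) u \<notin> \<Omega>))"

text \<open>The arcs are numbered \<open>0, \<dots>, J - 1\<close> cyclically along the boundary curve, arc \<open>j\<close>
  ending where arc \<open>(j + 1) mod J\<close> starts. Injectivity on the open parameter interval is what makes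
  them arcs; for \<open>J = 1\<close> the two end points coincide.\<close>

definition curvilinear_polygon :: "nat \<Rightarrow> (real^2) set \<Rightarrow> bool" where
  "curvilinear_polygon J \<Omega> \<longleftrightarrow>
     1 \<le> J \<and> bounded_Lipschitz_domain \<Omega> \<and>
     (\<exists>x :: nat \<Rightarrow> real \<Rightarrow> real^2.
        (\<forall>j<J. real_analytic_curve (x j) \<and>
               (\<exists>c>0. \<forall>t\<in>{0..1}. c \<le> (norm (velocity (x j) t))\<^sup>2) \<and>
               inj_on (x j) {0<..<1} \<and>
               x j 1 = x (Suc j mod J) 0) \<and>
        (\<forall>i<J. \<forall>j<J. i \<noteq> j \<longrightarrow> x i ` {0<..<1} \<inter> x j ` {0<..<1} = {}) \<and>
        frontier \<Omega> = (\<Union>j<J. closure (x j ` {0<..<1})) \<and>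
        (\<forall>j<J. \<exists>\<omega>\<in>{0<..<2 * pi}.
           has_interior_angle \<Omega> (x j 1)
             (velocity (x (Suc j mod J)) 0) (- velocity (x j) 1) \<omega>))"


section \<open>Smooth functions and analytic coefficients\<close>

definition partial :: "2 \<Rightarrow> (real^2 \<Rightarrow> 'b::real_normed_vector) \<Rightarrow> real^2 \<Rightarrow> 'b" where
  "partial i f x = vector_derivative (\<lambda>t. f (x + t *\<^sub>R axis i 1)) (at 0)"

text \<open>For an open set this says that the function is infinitely often differentiable on it.\<close>

definition smooth_on_open :: "(real^2) set \<Rightarrow> (real^2 \<Rightarrow> 'b::real_normed_vector) \<Rightarrow> bool" where
  "smooth_on_open S f \<longleftrightarrow> (\<forall>is. \<forall>x\<in>S. foldr partial is f differentiable (at x))"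

definition sum_derivs :: "nat \<Rightarrow> (real^2 \<Rightarrow> 'b::real_normed_vector) \<Rightarrow> real^2 \<Rightarrow> real" where
  "sum_derivs p f x =
     (\<Sum>(a, b) | a + b = p. norm (((partial 1 ^^ a) ((partial 2 ^^ b) f)) x))"

text \<open>The norm on matrices is the Frobenius norm; another choice only changes \<open>C\<close>.\<close>

definition analytic_coefficient :: "(real^2) set \<Rightarrow> (real^2 \<Rightarrow> real^2^2) \<Rightarrow> bool" where
  "analytic_coefficient \<Omega> A \<longleftrightarrow>
     smooth_on_open \<Omega> A \<and>
     (\<exists>C>0. \<forall>p. AE x in lebesgue_on \<Omega>. sum_derivs p A x \<le> C ^ (p + 1) * fact p)"

definition uniformly_positive_definite :: "(real^2) set \<Rightarrow> (real^2 \<Rightarrow> real^2^2) \<Rightarrow> bool" where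
  "uniformly_positive_definite \<Omega> A \<longleftrightarrow>
     (\<exists>c>0. \<forall>x\<in>\<Omega>. \<forall>\<xi>. c * (norm \<xi>)\<^sup>2 \<le> \<xi> \<bullet> (A x *v \<xi>))"


section \<open>Lebesgue and Sobolev spaces\<close>

text \<open>Elements are represented by functions on the whole plane, of which only the values almost
  everywhere on \<open>\<Omega>\<close> matter.\<close>

definition L2 :: "(real^2) set \<Rightarrow> (real^2 \<Rightarrow> real) set" where
  "L2 \<Omega> = {f. f \<in> borel_measurable (lebesgue_on \<Omega>) \<and> integrable (lebesgue_on \<Omega>) (\<lambda>x. (f x)\<^sup>2)}"

definition L2_inner :: "(real^2) set \<Rightarrow> (real^2 \<Rightarrow> real) \<Rightarrow> (real^2 \<Rightarrow> real) \<Rightarrow> real" where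
  "L2_inner \<Omega> f g = integral\<^sup>L (lebesgue_on \<Omega>) (\<lambda>x. f x * g x)"

definition L2_norm :: "(real^2) set \<Rightarrow> (real^2 \<Rightarrow> real) \<Rightarrow> real" where
  "L2_norm \<Omega> f = sqrt (L2_inner \<Omega> f f)"

definition test_functions :: "(real^2) set \<Rightarrow> (real^2 \<Rightarrow> real) set" where
  "test_functions \<Omega> =
     {\<psi>. smooth_on_open UNIV \<psi> \<and> compact (closure {x. \<psi> x \<noteq> 0}) \<and> closure {x. \<psi> x \<noteq> 0} \<subseteq> \<Omega>}"

definition is_weak_partial ::
    "(real^2) set \<Rightarrow> 2 \<Rightarrow> (real^2 \<Rightarrow> real) \<Rightarrow> (real^2 \<Rightarrow> real) \<Rightarrow> bool" where
  "is_weak_partial \<Omega> i u g \<longleftrightarrow>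
     (\<forall>\<psi>\<in>test_functions \<Omega>. L2_inner \<Omega> u (partial i \<psi>) = - L2_inner \<Omega> g \<psi>)"

definition H1 :: "(real^2) set \<Rightarrow> (real^2 \<Rightarrow> real) set" where
  "H1 \<Omega> = {u \<in> L2 \<Omega>. \<forall>i. \<exists>g\<in>L2 \<Omega>. is_weak_partial \<Omega> i u g}"

definition weak_grad :: "(real^2) set \<Rightarrow> (real^2 \<Rightarrow> real) \<Rightarrow> real^2 \<Rightarrow> real^2" where
  "weak_grad \<Omega> u x = (\<chi> i. (SOME g. g \<in> L2 \<Omega> \<and> is_weak_partial \<Omega> i u g) x)"

definition H1_norm :: "(real^2) set \<Rightarrow> (real^2 \<Rightarrow> real) \<Rightarrow> real" where
  "H1_norm \<Omega> u =
     sqrt (L2_inner \<Omega> u u + integral\<^sup>L (lebesgue_on \<Omega>) (\<lambda>x. (norm (weak_grad \<Omega> u x))\<^sup>2))"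

definition H10 :: "(real^2) set \<Rightarrow> (real^2 \<Rightarrow> real) set" where
  "H10 \<Omega> = {u \<in> H1 \<Omega>. \<forall>\<epsilon>>0. \<exists>\<psi>\<in>test_functions \<Omega>. H1_norm \<Omega> (\<lambda>x. u x - \<psi> x) < \<epsilon>}"


section \<open>The fractional operator\<close>

text \<open>The operator \<open>w \<mapsto> - div (A \<nabla>w)\<close> with homogeneous Dirichlet conditions, as a map from
  \<open>H10 \<Omega>\<close> into its dual.\<close>

definition dirichlet_op ::
    "(real^2) set \<Rightarrow> (real^2 \<Rightarrow> real^2^2) \<Rightarrow> (real^2 \<Rightarrow> real) \<Rightarrow> (real^2 \<Rightarrow> real) \<Rightarrow> real" where
  "dirichlet_op \<Omega> A w v =
     integral\<^sup>L (lebesgue_on \<Omega>) (\<lambda>x. (A x *v weak_grad \<Omega> w x) \<bullet> weak_grad \<Omega> v x)"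

text \<open>Eigenpairs are indexed from \<open>0\<close>.\<close>

definition dirichlet_eigenbasis ::
    "(real^2) set \<Rightarrow> (real^2 \<Rightarrow> real^2^2) \<Rightarrow> (nat \<Rightarrow> real) \<Rightarrow> (nat \<Rightarrow> real^2 \<Rightarrow> real) \<Rightarrow> bool" where
  "dirichlet_eigenbasis \<Omega> A lam \<phi> \<longleftrightarrow>
     (\<forall>k. \<phi> k \<in> H10 \<Omega> \<and> (\<forall>v\<in>H10 \<Omega>. dirichlet_op \<Omega> A (\<phi> k) v = lam k * L2_inner \<Omega> (\<phi> k) v)) \<and>
     (\<forall>j k. L2_inner \<Omega> (\<phi> j) (\<phi> k) = (if j = k then 1 else 0)) \<and>
     (\<forall>f\<in>L2 \<Omega>. (\<lambda>n. L2_norm \<Omega> (\<lambda>x. f x - (\<Sum>k<n. L2_inner \<Omega> f (\<phi> k) * \<phi> k x))) \<longlonglongrightarrow> 0)"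

definition frac_space ::
    "(real^2) set \<Rightarrow> (nat \<Rightarrow> real) \<Rightarrow> (nat \<Rightarrow> real^2 \<Rightarrow> real) \<Rightarrow> real \<Rightarrow> (real^2 \<Rightarrow> real) set" where
  "frac_space \<Omega> lam \<phi> \<sigma> =
     {v \<in> L2 \<Omega>. summable (\<lambda>k. lam k powr \<sigma> * (L2_inner \<Omega> v (\<phi> k))\<^sup>2)}"

definition frac_norm ::
    "(real^2) set \<Rightarrow> (nat \<Rightarrow> real) \<Rightarrow> (nat \<Rightarrow> real^2 \<Rightarrow> real) \<Rightarrow> real \<Rightarrow> (real^2 \<Rightarrow> real) \<Rightarrow> real" where
  "frac_norm \<Omega> lam \<phi> \<sigma> v = sqrt (\<Sum>k. lam k powr \<sigma> * (L2_inner \<Omega> v (\<phi> k))\<^sup>2)"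

text \<open>The power with exponent \<open>s\<close> of the operator, with value the functional
  \<open>\<Sum>k. lam k powr s * v\<^sub>k * \<phi> k\<close> in the dual of \<open>frac_space \<Omega> lam \<phi> s\<close>, evaluated
  at \<open>w\<close>.\<close>

definition frac_op ::
    "(real^2) set \<Rightarrow> (nat \<Rightarrow> real) \<Rightarrow> (nat \<Rightarrow> real^2 \<Rightarrow> real) \<Rightarrow> real
       \<Rightarrow> (real^2 \<Rightarrow> real) \<Rightarrow> (real^2 \<Rightarrow> real) \<Rightarrow> real" where
  "frac_op \<Omega> lam \<phi> s v w =
     (\<Sum>k. lam k powr s * L2_inner \<Omega> v (\<phi> k) * L2_inner \<Omega> (\<phi> k) w)"

text \<open>The inverse of \<open>frac_op\<close> on right-hand sides in \<open>L2 \<Omega>\<close>, which act on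
  \<open>frac_space \<Omega> lam \<phi> s\<close> through the inner product of \<open>L2 \<Omega>\<close>. The solution is unique almost
  everywhere, and some representative of it is chosen.\<close>

definition frac_inv ::
    "(real^2) set \<Rightarrow> (nat \<Rightarrow> real) \<Rightarrow> (nat \<Rightarrow> real^2 \<Rightarrow> real) \<Rightarrow> real
       \<Rightarrow> (real^2 \<Rightarrow> real) \<Rightarrow> real^2 \<Rightarrow> real" where
  "frac_inv \<Omega> lam \<phi> s f =
     (SOME v. v \<in> frac_space \<Omega> lam \<phi> s \<and>
        (\<forall>w\<in>frac_space \<Omega> lam \<phi> s. frac_op \<Omega> lam \<phi> s v w = L2_inner \<Omega> f w))"


section \<open>Data with a holomorphic extension\<close>

definition of_real2 :: "real^2 \<Rightarrow> complex^2" where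
  "of_real2 x = (\<chi> i. complex_of_real (x $ i))"

definition holomorphic2_on :: "(complex^2 \<Rightarrow> complex) \<Rightarrow> (complex^2) set \<Rightarrow> bool" where
  "holomorphic2_on F G \<longleftrightarrow>
     (\<forall>z\<in>G. \<exists>D. (F has_derivative D) (at z) \<and> (\<forall>c w. D (c *s w) = c * D w))"

definition analytic_data :: "(real^2) set \<Rightarrow> (complex^2) set \<Rightarrow> (real^2 \<Rightarrow> real) set" where
  "analytic_data \<Omega> G =
     {f \<in> L2 \<Omega>. \<exists>F. holomorphic2_on F G \<and>
        (\<forall>x\<in>\<Omega>. F (of_real2 x) = complex_of_real (f x)) \<and>
        (AE z in lebesgue_on G. norm (F z) \<le> 1)}"


section \<open>Kolmogorov widths\<close>

text \<open>The normed space is the quotient of the function space \<open>X\<close> by the null space of the seminorm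
  \<open>nrm\<close> (here: equality almost everywhere on \<open>\<Omega>\<close>), so linear independence is understood modulo
  \<open>nrm\<close>-null functions.\<close>

definition subspaces_of_dim ::
    "('a \<Rightarrow> real) set \<Rightarrow> (('a \<Rightarrow> real) \<Rightarrow> real) \<Rightarrow> nat \<Rightarrow> ('a \<Rightarrow> real) set set" where
  "subspaces_of_dim X nrm N =
     {E. \<exists>e. (\<forall>i<N. e i \<in> X) \<and>
             (\<forall>c. nrm (\<lambda>x. \<Sum>i<N. c i * e i x) = 0 \<longrightarrow> (\<forall>i<N. c i = 0)) \<and>
             E = range (\<lambda>c :: nat \<Rightarrow> real. \<lambda>x. \<Sum>i<N. c i * e i x)}"

definition kolmogorov_width ::
    "nat \<Rightarrow> ('a \<Rightarrow> real) set \<Rightarrow> ('a \<Rightarrow> real) set \<Rightarrow> (('a \<Rightarrow> real) \<Rightarrow> real) \<Rightarrow> ennreal" where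
  "kolmogorov_width N K X nrm =
     (INF E\<in>subspaces_of_dim X nrm N. SUP f\<in>K. INF g\<in>E. ennreal (nrm (\<lambda>x. f x - g x)))"

end

theory Submission
  imports Defs "HOL-Complex_Analysis.Cauchy_Integral_Formula"
begin

text \<open>Since the eigenvalues are bounded below by a positive number (Poincare inequality), \<open>L^(-s)\<close> is
  bounded from \<open>L\<^sup>2\<close> to \<open>H^s\<close>, so a good linear approximation of the data in \<open>L\<^sup>2\<close> is mapped to an
  equally good one of the solutions. The data are approximated on finitely many small boxes, whose
  complex enlargements lie in \<open>G\<close>, by polynomials of degree below \<open>p\<close> in each variable: with
  \<open>N = M p\<^sup>2\<close> functions the error is \<open>O(2 powr - p)\<close>. This even gives the rate \<open>exp (- b * sqrt N)\<close>.\<close>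

section \<open>Square-integrable functions\<close>

text \<open>Approximating the solutions directly would have to cope with their singular behaviour
  near the boundary and the vertices. Here the approximating space is built from solutions whose
  data are piecewise polynomials, so it carries that behaviour itself, and the error is governed by
  the \<open>L2\<close> error of the data. The base 2 of the rate comes from using Taylor
  polynomials on half the radius on which Cauchy's estimates hold. The boxes depend only on the room
  that \<open>G\<close> leaves around the closure of \<open>\<Omega>\<close>, not on the degree or
  the datum, so their number \<open>M\<close> stays fixed as \<open>N\<close> grows.

  Two features of the setting shape the end of the proof. \<open>frac_inv\<close> returns a
  representative picked by choice, hence is linear only up to null functions; arguments about it go
  through the coefficients \<open>L2_inner \<Omega> v (\<phi> k)\<close>. And
  \<open>subspaces_of_dim\<close> asks for exactly \<open>N\<close> elements that are independent
  modulo null functions, whereas the solutions for the polynomial data may be dependent. They are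
  therefore replaced by an orthonormal family of length \<open>N\<close>, completed with the help of
  eigenfunctions.\<close>

lemma L2_measurable: "f \<in> L2 \<Omega> \<Longrightarrow> f \<in> borel_measurable (lebesgue_on \<Omega>)"
  by (simp add: L2_def)

lemma L2_mult_integrable:
  assumes "f \<in> L2 \<Omega>" "g \<in> L2 \<Omega>"
  shows "integrable (lebesgue_on \<Omega>) (\<lambda>x. f x * g x)"
proof (rule Bochner_Integration.integrable_bound)
  show "integrable (lebesgue_on \<Omega>) (\<lambda>x. (f x)\<^sup>2 + (g x)\<^sup>2)"
    using assms by (auto simp: L2_def)
  show "(\<lambda>x. f x * g x) \<in> borel_measurable (lebesgue_on \<Omega>)"
    using assms by (auto simp: L2_def)
  have "\<bar>a * b\<bar> \<le> a\<^sup>2 + b\<^sup>2" for a b :: real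
  proof -
    have "0 \<le> (\<bar>a\<bar> - \<bar>b\<bar>)\<^sup>2" by simp
    then have "2 * (\<bar>a\<bar> * \<bar>b\<bar>) \<le> a\<^sup>2 + b\<^sup>2" by (simp add: power2_diff)
    moreover have "0 \<le> \<bar>a\<bar> * \<bar>b\<bar>" by simp
    ultimately show ?thesis unfolding abs_mult by linarith
  qed
  then show "AE x in lebesgue_on \<Omega>. norm (f x * g x) \<le> norm ((f x)\<^sup>2 + (g x)\<^sup>2)"
    by (auto intro!: AE_I2)
qed

lemma L2_add [intro]:
  assumes "f \<in> L2 \<Omega>" "g \<in> L2 \<Omega>"
  shows "(\<lambda>x. f x + g x) \<in> L2 \<Omega>"
proof -
  have "integrable (lebesgue_on \<Omega>) (\<lambda>x. (f x)\<^sup>2 + (g x)\<^sup>2 + 2 * (f x * g x))"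
    using assms L2_mult_integrable[OF assms] by (auto simp: L2_def)
  then show ?thesis
    using assms by (auto simp: L2_def power2_sum mult.assoc)
qed

lemma L2_cmult [intro]: "f \<in> L2 \<Omega> \<Longrightarrow> (\<lambda>x. c * f x) \<in> L2 \<Omega>"
  by (auto simp: L2_def power_mult_distrib)

lemma L2_diff [intro]:
  assumes "f \<in> L2 \<Omega>" "g \<in> L2 \<Omega>"
  shows "(\<lambda>x. f x - g x) \<in> L2 \<Omega>"
  using L2_add[OF assms(1) L2_cmult[OF assms(2), of "-1"]] by simp

lemma L2_zero [simp]: "(\<lambda>x. 0) \<in> L2 \<Omega>"
  by (simp add: L2_def)

lemma L2_sum [intro]: "(\<And>i. i \<in> I \<Longrightarrow> f i \<in> L2 \<Omega>) \<Longrightarrow> (\<lambda>x. \<Sum>i\<in>I. f i x) \<in> L2 \<Omega>"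
  by (induction I rule: infinite_finite_induct) auto

lemma L2_inner_commute: "L2_inner \<Omega> f g = L2_inner \<Omega> g f"
  by (simp add: L2_inner_def mult.commute)

lemma L2_inner_add_left:
  "f \<in> L2 \<Omega> \<Longrightarrow> g \<in> L2 \<Omega> \<Longrightarrow> h \<in> L2 \<Omega> \<Longrightarrow>
    L2_inner \<Omega> (\<lambda>x. f x + g x) h = L2_inner \<Omega> f h + L2_inner \<Omega> g h"
  by (simp add: L2_inner_def distrib_right L2_mult_integrable)

lemma L2_inner_diff_left:
  "f \<in> L2 \<Omega> \<Longrightarrow> g \<in> L2 \<Omega> \<Longrightarrow> h \<in> L2 \<Omega> \<Longrightarrow>
    L2_inner \<Omega> (\<lambda>x. f x - g x) h = L2_inner \<Omega> f h - L2_inner \<Omega> g h"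
  by (simp add: L2_inner_def left_diff_distrib L2_mult_integrable)

lemma L2_inner_diff_right:
  "f \<in> L2 \<Omega> \<Longrightarrow> g \<in> L2 \<Omega> \<Longrightarrow> h \<in> L2 \<Omega> \<Longrightarrow>
    L2_inner \<Omega> h (\<lambda>x. f x - g x) = L2_inner \<Omega> h f - L2_inner \<Omega> h g"
  by (simp add: L2_inner_commute[of \<Omega> h] L2_inner_diff_left)

lemma L2_inner_cmult_left: "L2_inner \<Omega> (\<lambda>x. c * f x) h = c * L2_inner \<Omega> f h"
  by (simp add: L2_inner_def mult.assoc)

lemma L2_inner_cmult_right: "L2_inner \<Omega> h (\<lambda>x. c * f x) = c * L2_inner \<Omega> h f"
  by (simp add: L2_inner_commute[of \<Omega> h] L2_inner_cmult_left)

lemma L2_inner_sum_left: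
  assumes "h \<in> L2 \<Omega>" "\<And>i. i \<in> I \<Longrightarrow> f i \<in> L2 \<Omega>"
  shows "L2_inner \<Omega> (\<lambda>x. \<Sum>i\<in>I. c i * f i x) h = (\<Sum>i\<in>I. c i * L2_inner \<Omega> (f i) h)"
proof -
  have "L2_inner \<Omega> (\<lambda>x. \<Sum>i\<in>I. c i * f i x) h = (\<integral>x. (\<Sum>i\<in>I. c i * (f i x * h x)) \<partial>lebesgue_on \<Omega>)"
    by (simp add: L2_inner_def sum_distrib_right mult.assoc)
  also have "\<dots> = (\<Sum>i\<in>I. c i * L2_inner \<Omega> (f i) h)"
    using assms by (subst Bochner_Integration.integral_sum) (auto simp: L2_inner_def L2_mult_integrable)
  finally show ?thesis .
qed

lemma L2_inner_self_nonneg: "0 \<le> L2_inner \<Omega> f f"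
  by (simp add: L2_inner_def)

lemma L2_norm_sq: "(L2_norm \<Omega> f)\<^sup>2 = L2_inner \<Omega> f f"
  by (simp add: L2_norm_def L2_inner_self_nonneg)

lemma L2_norm_nonneg: "0 \<le> L2_norm \<Omega> f"
  by (simp add: L2_norm_def L2_inner_self_nonneg)

lemma L2_inner_diff_self:
  assumes "f \<in> L2 \<Omega>" "g \<in> L2 \<Omega>"
  shows "L2_inner \<Omega> (\<lambda>x. f x - g x) (\<lambda>x. f x - g x)
    = L2_inner \<Omega> f f - 2 * L2_inner \<Omega> f g + L2_inner \<Omega> g g"
  using assms by (simp add: L2_inner_diff_left L2_inner_diff_right L2_diff L2_inner_commute[of \<Omega> g f])

text \<open>The discriminant argument: the squared norm of \<open>f - t * g\<close> is a quadratic
  polynomial in \<open>t\<close> without negative values.\<close>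

lemma L2_Cauchy_Schwarz:
  assumes "f \<in> L2 \<Omega>" "g \<in> L2 \<Omega>"
  shows "\<bar>L2_inner \<Omega> f g\<bar> \<le> L2_norm \<Omega> f * L2_norm \<Omega> g"
proof -
  define a b c where "a = L2_inner \<Omega> f f" and "b = L2_inner \<Omega> f g" and "c = L2_inner \<Omega> g g"
  have ac: "0 \<le> a" "0 \<le> c" by (simp_all add: a_def c_def L2_inner_self_nonneg)
  have q: "0 \<le> a - 2 * (t * b) + t * (t * c)" for t
  proof -
    have "0 \<le> L2_inner \<Omega> (\<lambda>x. f x - t * g x) (\<lambda>x. f x - t * g x)"
      by (rule L2_inner_self_nonneg)
    then show ?thesis
      using assms by (simp add: L2_inner_diff_self L2_cmult L2_inner_cmult_left L2_inner_cmult_right a_def b_def c_def)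
  qed
  have "b\<^sup>2 \<le> a * c"
  proof (cases "c = 0")
    case True
    have "b = 0"
    proof (rule ccontr)
      assume "b \<noteq> 0"
      \<comment> \<open>With \<open>c = 0\<close> the polynomial is affine in \<open>t\<close>; this
        \<open>t\<close> gives it the value -1.\<close>
      then show False using q[of "(a + 1) / (2 * b)"] True ac by (simp add: field_simps)
    qed
    then show ?thesis using ac True by simp
  next
    case False
    then have "c > 0" using ac by simp
    have "a - 2 * (b / c * b) + b / c * (b / c * c) = a - b * b / c" using False by (simp add: field_simps)
    then have "0 \<le> a - b * b / c"
      using q[of "b / c"] by metis
    then show ?thesis using \<open>c > 0\<close> by (simp add: field_simps power2_eq_square)
  qed
  then have "sqrt (b\<^sup>2) \<le> sqrt (a * c)" by (rule real_sqrt_le_mono)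
  then show ?thesis by (simp add: L2_norm_def a_def b_def c_def real_sqrt_mult)
qed

lemma L2_norm_triangle:
  assumes "f \<in> L2 \<Omega>" "g \<in> L2 \<Omega>"
  shows "L2_norm \<Omega> (\<lambda>x. f x - g x) \<le> L2_norm \<Omega> f + L2_norm \<Omega> g"
proof (rule power2_le_imp_le)
  have "- L2_inner \<Omega> f g \<le> L2_norm \<Omega> f * L2_norm \<Omega> g"
    using L2_Cauchy_Schwarz[OF assms] by linarith
  then show "(L2_norm \<Omega> (\<lambda>x. f x - g x))\<^sup>2 \<le> (L2_norm \<Omega> f + L2_norm \<Omega> g)\<^sup>2"
    using assms by (simp add: power2_sum L2_norm_sq L2_inner_diff_self)
  show "0 \<le> L2_norm \<Omega> f + L2_norm \<Omega> g" by (simp add: L2_norm_nonneg)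
qed

lemma L2_bounded:
  assumes "\<Omega> \<in> lmeasurable" "f \<in> borel_measurable (lebesgue_on \<Omega>)" "\<And>x. x \<in> \<Omega> \<Longrightarrow> \<bar>f x\<bar> \<le> B"
  shows "f \<in> L2 \<Omega>"
    and "L2_norm \<Omega> f \<le> B * sqrt (measure lebesgue \<Omega>)"
proof -
  have Om: "\<Omega> \<in> sets lebesgue" using assms by auto
  have fin: "integrable (lebesgue_on \<Omega>) (\<lambda>x. B\<^sup>2)"
    
    using finite_measure.integrable_const[of "lebesgue_on \<Omega>"] finite_measure_lebesgue_on[OF assms(1)] by blast
  have sq: "(f x)\<^sup>2 \<le> B\<^sup>2" if "x \<in> \<Omega>" for x
    using assms(3)[OF that] by (metis abs_ge_zero power2_abs power_mono)
  have i: "integrable (lebesgue_on \<Omega>) (\<lambda>x. (f x)\<^sup>2)"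
    by (rule Bochner_Integration.integrable_bound[OF fin]) (use assms(2) sq in \<open>auto intro!: AE_I2\<close>)
  then show f: "f \<in> L2 \<Omega>" using assms(2) by (simp add: L2_def)
  have "L2_inner \<Omega> f f \<le> (\<integral>x. B\<^sup>2 \<partial>lebesgue_on \<Omega>)"
    unfolding L2_inner_def
    by (rule integral_mono) (use i sq fin in \<open>auto simp: power2_eq_square\<close>)
  also have "\<dots> = B\<^sup>2 * measure lebesgue \<Omega>"
    using Om by (simp add: measure_restrict_space)
  finally have le: "L2_norm \<Omega> f \<le> sqrt (B\<^sup>2 * measure lebesgue \<Omega>)"
    unfolding L2_norm_def by (rule real_sqrt_le_mono)
  show "L2_norm \<Omega> f \<le> B * sqrt (measure lebesgue \<Omega>)"
  \<comment> \<open>Only a point of \<open>\<Omega>\<close> forces \<open>B\<close> to be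
    nonnegative; on the empty set both sides are 0 whatever the sign of \<open>B\<close>.\<close>
  proof (cases "\<Omega> = {}")
    case True
    then show ?thesis using le by simp
  next
    case False
    then have "0 \<le> B" using assms(3) by fastforce
    then show ?thesis using le by (simp add: real_sqrt_mult)
  qed
qed

section \<open>Orthonormal sums and completeness of \<open>L2\<close>\<close>

lemma L2_inner_orthonormal_sum:
  assumes "finite I" and \<phi>: "\<And>k. k \<in> I \<Longrightarrow> \<phi> k \<in> L2 \<Omega>"
    and orth: "\<And>j k. j \<in> I \<Longrightarrow> k \<in> I \<Longrightarrow> L2_inner \<Omega> (\<phi> j) (\<phi> k) = (if j = k then 1 else 0)"
  shows "j \<in> I \<Longrightarrow> L2_inner \<Omega> (\<lambda>x. \<Sum>k\<in>I. a k * \<phi> k x) (\<phi> j) = a j"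
    and "L2_inner \<Omega> (\<lambda>x. \<Sum>k\<in>I. a k * \<phi> k x) (\<lambda>x. \<Sum>k\<in>I. a k * \<phi> k x) = (\<Sum>k\<in>I. (a k)\<^sup>2)"
proof -
  let ?S = "\<lambda>x. \<Sum>k\<in>I. a k * \<phi> k x"
  show *: "L2_inner \<Omega> ?S (\<phi> j) = a j" if "j \<in> I" for j
  proof -
    have "L2_inner \<Omega> ?S (\<phi> j) = (\<Sum>i\<in>I. if i = j then a i else 0)"
      using \<phi> that by (subst L2_inner_sum_left) (auto simp: orth intro!: sum.cong)
    also have "\<dots> = a j" using \<open>finite I\<close> that by simp
    finally show ?thesis .
  qed
  have S: "?S \<in> L2 \<Omega>" using \<phi> by (intro L2_sum L2_cmult)
  have "L2_inner \<Omega> ?S ?S = (\<Sum>i\<in>I. a i * L2_inner \<Omega> (\<phi> i) ?S)"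
    using \<phi> S by (subst L2_inner_sum_left) auto
  also have "\<dots> = (\<Sum>k\<in>I. (a k)\<^sup>2)"
    by (rule sum.cong) (simp_all add: L2_inner_commute[of \<Omega> "\<phi> _"] * power2_eq_square)
  finally show "L2_inner \<Omega> ?S ?S = (\<Sum>k\<in>I. (a k)\<^sup>2)" .
qed

text \<open>Consecutive blocks of norm at most \<open>2 ^ - n\<close> are summable in \<open>L\<^sup>1\<close> because the measure is
  finite, hence converge almost everywhere; Fatou's lemma then gives convergence in \<open>L\<^sup>2\<close>.\<close>

lemma L2_fast_Cauchy_converges:
  assumes Om: "\<Omega> \<in> lmeasurable" and u: "\<And>n. u n \<in> L2 \<Omega>"
    and dist: "\<And>m n. n \<le> m \<Longrightarrow> L2_norm \<Omega> (\<lambda>x. u m x - u n x) \<le> (1/2) ^ n"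
  shows "\<exists>v\<in>L2 \<Omega>. \<forall>n. L2_norm \<Omega> (\<lambda>x. v x - u n x) \<le> (1/2) ^ n"
proof -
  let ?M = "lebesgue_on \<Omega>"
  have [measurable]: "u n \<in> borel_measurable ?M" for n using u by (rule L2_measurable)
  define V where "V = sqrt (measure lebesgue \<Omega>)"
  have V0: "0 \<le> V" by (simp add: V_def)
  have one: "(\<lambda>x. 1) \<in> L2 \<Omega>" "L2_norm \<Omega> (\<lambda>x. 1) \<le> V"
    using L2_bounded[OF Om, of "\<lambda>x. 1" 1] by (auto simp: V_def)
  define d where "d n x = \<bar>u (Suc n) x - u n x\<bar>" for n x
  have dL2: "d n \<in> L2 \<Omega>" for n
    unfolding d_def using L2_diff[OF u u, of "Suc n" n] by (auto simp: L2_def)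
  have dn: "L2_norm \<Omega> (d n) \<le> (1/2) ^ n" for n
    using dist[of n "Suc n"] by (simp add: L2_norm_def L2_inner_def d_def)
  have d1: "(\<integral>\<^sup>+x. ennreal (d n x) \<partial>?M) \<le> ennreal ((1/2)^n * V)" for n
  proof -
    have "integrable ?M (d n)" using L2_mult_integrable[OF dL2 one(1)] by simp
    then have "(\<integral>\<^sup>+x. ennreal (d n x) \<partial>?M) = ennreal (integral\<^sup>L ?M (d n))"
      by (rule nn_integral_eq_integral) (simp add: d_def)
    also have "integral\<^sup>L ?M (d n) = L2_inner \<Omega> (d n) (\<lambda>x. 1)" by (simp add: L2_inner_def)
    also have "L2_inner \<Omega> (d n) (\<lambda>x. 1) \<le> L2_norm \<Omega> (d n) * L2_norm \<Omega> (\<lambda>x. 1)"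
      using L2_Cauchy_Schwarz[OF dL2 one(1)] by (meson abs_ge_self order_trans)
    also have "\<dots> \<le> (1/2)^n * V"
      using dn one by (intro mult_mono) (auto simp: L2_norm_nonneg)
    finally show ?thesis by (simp add: ennreal_leI)
  qed
  have [measurable]: "d n \<in> borel_measurable ?M" for n using dL2 by (rule L2_measurable)
  have sm: "summable (\<lambda>n. (1/2)^n * V :: real)" by (intro summable_mult2 summable_geometric) auto
  have "(\<integral>\<^sup>+x. (\<Sum>n. ennreal (d n x)) \<partial>?M) = (\<Sum>n. \<integral>\<^sup>+x. ennreal (d n x) \<partial>?M)"
    by (rule nn_integral_suminf) measurable
  also have "\<dots> \<le> (\<Sum>n. ennreal ((1/2)^n * V))" by (intro suminf_le d1) auto
  also have "\<dots> = ennreal (\<Sum>n. (1/2)^n * V)" using sm V0 by (intro suminf_ennreal_eq) (auto simp: summable_sums)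
  finally have "(\<integral>\<^sup>+x. (\<Sum>n. ennreal (d n x)) \<partial>?M) \<noteq> \<infinity>" by (auto simp: top_unique)
  then have "AE x in ?M. (\<Sum>n. ennreal (d n x)) \<noteq> \<infinity>"
    by (intro nn_integral_PInf_AE) auto
  then have conv: "AE x in ?M. convergent (\<lambda>n. u n x)"
  proof (rule eventually_mono)
    fix x assume "(\<Sum>n. ennreal (d n x)) \<noteq> \<infinity>"
    then have "summable (\<lambda>n. d n x)"
      by (intro summable_suminf_not_top) (auto simp: d_def)
    then have "summable (\<lambda>n. u (Suc n) x - u n x)"
      unfolding d_def by (rule summable_rabs_cancel)
    then have "convergent (\<lambda>n. \<Sum>k<n. u (Suc k) x - u k x)" by (simp add: summable_iff_convergent)
    then have "convergent (\<lambda>n. u n x - u 0 x)" by (simp only: sum_lessThan_telescope[of "\<lambda>n. u n x" for x])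
    then show "convergent (\<lambda>n. u n x)" using convergent_diff_const_right_iff by blast
  qed
  \<comment> \<open>Where the sequence diverges, \<open>lim\<close> has an unspecified value; by
    \<open>conv\<close> these points form a null set.\<close>
  define v where "v x = lim (\<lambda>n. u n x)" for x
  have [measurable]: "v \<in> borel_measurable ?M" unfolding v_def by measurable
  have dv: "(\<lambda>x. v x - u n x) \<in> L2 \<Omega> \<and> L2_norm \<Omega> (\<lambda>x. v x - u n x) \<le> (1/2)^n" for n
  proof -
    have "(\<integral>\<^sup>+x. ennreal ((v x - u n x)\<^sup>2) \<partial>?M) = (\<integral>\<^sup>+x. liminf (\<lambda>m. ennreal ((u m x - u n x)\<^sup>2)) \<partial>?M)"
    proof (rule nn_integral_cong_AE, rule eventually_mono[OF conv])
      fix x assume "convergent (\<lambda>n. u n x)"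
      then have "(\<lambda>m. u m x) \<longlonglongrightarrow> v x" by (simp add: v_def convergent_LIMSEQ_iff)
      then have "(\<lambda>m. ennreal ((u m x - u n x)\<^sup>2)) \<longlonglongrightarrow> ennreal ((v x - u n x)\<^sup>2)"
        by (intro tendsto_intros)
      then show "ennreal ((v x - u n x)\<^sup>2) = liminf (\<lambda>m. ennreal ((u m x - u n x)\<^sup>2))"
        by (metis lim_imp_Liminf sequentially_bot)
    qed
    also have "\<dots> \<le> liminf (\<lambda>m. \<integral>\<^sup>+x. ennreal ((u m x - u n x)\<^sup>2) \<partial>?M)"
      by (rule nn_integral_liminf) measurable
    also have "\<dots> \<le> ennreal (((1/2)^n)\<^sup>2)"
    proof (rule Liminf_le)
      show "sequentially \<noteq> bot" by simp
      show "\<forall>\<^sub>F m in sequentially. (\<integral>\<^sup>+x. ennreal ((u m x - u n x)\<^sup>2) \<partial>?M) \<le> ennreal (((1/2)^n)\<^sup>2)"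
        using eventually_ge_at_top[of n]
      proof eventually_elim
        case (elim m)
        have "(\<integral>\<^sup>+x. ennreal ((u m x - u n x)\<^sup>2) \<partial>?M) = ennreal ((L2_norm \<Omega> (\<lambda>x. u m x - u n x))\<^sup>2)"
          using L2_diff[OF u u, of m n]
          by (subst nn_integral_eq_integral) (auto simp: L2_def L2_norm_sq L2_inner_def simp flip: power2_eq_square)
        also have "\<dots> \<le> ennreal (((1/2)^n)\<^sup>2)"
          using dist[OF elim] by (intro ennreal_leI power_mono) (auto simp: L2_norm_nonneg)
        finally show ?case .
      qed
    qed
    finally have le: "(\<integral>\<^sup>+x. ennreal ((v x - u n x)\<^sup>2) \<partial>?M) \<le> ennreal (((1/2)^n)\<^sup>2)" .
    have int: "integrable ?M (\<lambda>x. (v x - u n x)\<^sup>2)"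
    proof (rule integrableI_bounded)
      have "(\<integral>\<^sup>+x. ennreal (norm ((v x - u n x)\<^sup>2)) \<partial>?M) \<le> ennreal (((1/2)^n)\<^sup>2)" using le by simp
      then show "(\<integral>\<^sup>+x. ennreal (norm ((v x - u n x)\<^sup>2)) \<partial>?M) < \<infinity>"
        by (rule order.strict_trans1) simp
    qed measurable
    have "integral\<^sup>L ?M (\<lambda>x. (v x - u n x)\<^sup>2) \<le> ((1/2)^n)\<^sup>2"
      using le by (simp add: nn_integral_eq_integral[OF int])
    then have "(L2_norm \<Omega> (\<lambda>x. v x - u n x))\<^sup>2 \<le> ((1/2)^n)\<^sup>2"
      by (simp add: L2_norm_sq L2_inner_def flip: power2_eq_square)
    then have "L2_norm \<Omega> (\<lambda>x. v x - u n x) \<le> (1/2)^n"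
      by (rule power2_le_imp_le) simp
    then show ?thesis using int by (simp add: L2_def)
  qed
  have "v \<in> L2 \<Omega>"
    using L2_add[OF conjunct1[OF dv, of 0] u[of 0]] by simp
  then show ?thesis using dv by (intro bexI[of _ v]) auto
qed

text \<open>Produces a function from prescribed coefficients; this is where the existence of
  solutions of the fractional equation comes from. Partial sums along a sparse sequence of indices
  are close enough together for \<open>L2_fast_Cauchy_converges\<close>.\<close>

lemma Riesz_Fischer:
  fixes \<phi> :: "nat \<Rightarrow> real^2 \<Rightarrow> real"
  assumes Om: "\<Omega> \<in> lmeasurable" and \<phi>: "\<And>k. \<phi> k \<in> L2 \<Omega>"
    and orth: "\<And>j k. L2_inner \<Omega> (\<phi> j) (\<phi> k) = (if j = k then 1 else 0)"
    and a: "summable (\<lambda>k. (a k)\<^sup>2)"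
  shows "\<exists>v\<in>L2 \<Omega>. \<forall>k. L2_inner \<Omega> v (\<phi> k) = a k"
proof -
  have "\<exists>r. \<forall>n m. r \<le> n \<longrightarrow> n \<le> m \<longrightarrow> (\<Sum>k=n..<m. (a k)\<^sup>2) \<le> ((1/2)^i)\<^sup>2" for i :: nat
  proof -
    have "0 < ((1/2::real)^i)\<^sup>2" by simp
    then obtain N where N: "\<forall>m\<ge>N. \<forall>n. norm (\<Sum>k=m..<n. (a k)\<^sup>2) < ((1/2)^i)\<^sup>2"
      using a unfolding summable_Cauchy by blast
    have "(\<Sum>k=n..<m. (a k)\<^sup>2) \<le> ((1/2)^i)\<^sup>2" if "N \<le> n" for n m
      using N[rule_format, OF that, of m] by simp
    then show ?thesis by blast
  qed
  then obtain r0 where r0: "\<And>i n m. r0 i \<le> n \<Longrightarrow> n \<le> m \<Longrightarrow> (\<Sum>k=n..<m. (a k)\<^sup>2) \<le> ((1/2)^i)\<^sup>2"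
    using choice[of "\<lambda>i r. \<forall>n m. r \<le> n \<longrightarrow> n \<le> m \<longrightarrow> (\<Sum>k=n..<m. (a k)\<^sup>2) \<le> ((1/2)^i)\<^sup>2"] by blast
  \<comment> \<open>Summing all earlier thresholds makes \<open>r\<close> monotone; the extra
    \<open>n\<close> guarantees that the coefficient with index \<open>k\<close> is already
    contained in \<open>u n\<close> as soon as \<open>k < n\<close>.\<close>
  define r where "r n = n + (\<Sum>i\<le>n. r0 i)" for n
  have r_ge: "r0 n \<le> r n" "n \<le> r n" for n
    unfolding r_def by (auto intro: trans_le_add2 member_le_sum)
  have r_mono: "r n \<le> r m" if "n \<le> m" for n m
    unfolding r_def using that by (intro add_mono sum_mono2) auto
  define u where "u n x = (\<Sum>k<r n. a k * \<phi> k x)" for n x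
  have u: "u n \<in> L2 \<Omega>" for n unfolding u_def using \<phi> by (intro L2_sum L2_cmult)
  have u_dist: "L2_norm \<Omega> (\<lambda>x. u m x - u n x) \<le> (1/2) ^ n" if "n \<le> m" for m n
  proof -
    have "{..<r m} - {..<r n} = {r n..<r m}" by auto
    then have "(\<lambda>x. u m x - u n x) = (\<lambda>x. \<Sum>k\<in>{r n..<r m}. a k * \<phi> k x)"
      unfolding u_def using r_mono[OF that]
      by (intro ext) (subst sum_diff[symmetric], auto)
    then have "(L2_norm \<Omega> (\<lambda>x. u m x - u n x))\<^sup>2 = (\<Sum>k=r n..<r m. (a k)\<^sup>2)"
      by (simp add: L2_norm_sq L2_inner_orthonormal_sum(2)[OF _ \<phi> orth])
    also have "\<dots> \<le> ((1/2)^n)\<^sup>2" using r0 r_ge r_mono that by blast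
    finally show ?thesis by (rule power2_le_imp_le) simp
  qed
  obtain v where v: "v \<in> L2 \<Omega>" "\<And>n. L2_norm \<Omega> (\<lambda>x. v x - u n x) \<le> (1/2) ^ n"
    using L2_fast_Cauchy_converges[of \<Omega> u, OF Om u u_dist] by auto
  have "L2_inner \<Omega> v (\<phi> k) = a k" for k
  proof -
    have "\<bar>L2_inner \<Omega> v (\<phi> k) - a k\<bar> \<le> (1/2)^n" if "k < n" for n
    proof -
      have "L2_inner \<Omega> (u n) (\<phi> k) = a k"
        unfolding u_def using r_ge(2)[of n] that by (simp add: L2_inner_orthonormal_sum(1)[OF _ \<phi> orth])
      then have "\<bar>L2_inner \<Omega> v (\<phi> k) - a k\<bar> = \<bar>L2_inner \<Omega> (\<lambda>x. v x - u n x) (\<phi> k)\<bar>"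
        by (simp add: L2_inner_diff_left v u \<phi>)
      also have "\<dots> \<le> L2_norm \<Omega> (\<lambda>x. v x - u n x) * L2_norm \<Omega> (\<phi> k)"
        by (intro L2_Cauchy_Schwarz L2_diff v u \<phi>)
      also have "\<dots> \<le> (1/2)^n" using v(2)[of n] by (simp add: L2_norm_def[of _ "\<phi> k"] orth)
      finally show ?thesis .
    qed
    then have "\<forall>\<^sub>F n in sequentially. \<bar>L2_inner \<Omega> v (\<phi> k) - a k\<bar> \<le> (1/2)^n"
      by (auto intro: eventually_mono[OF eventually_gt_at_top[of k]])
    moreover have "(\<lambda>n. (1/2::real)^n) \<longlonglongrightarrow> 0" by (rule LIMSEQ_power_zero) simp
    ultimately have "\<bar>L2_inner \<Omega> v (\<phi> k) - a k\<bar> \<le> 0"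
      by (intro tendsto_lowerbound[where f="\<lambda>n. (1/2::real)^n"]) auto
    then show ?thesis by simp
  qed
  then show ?thesis using v(1) by blast
qed

section \<open>The Poincare inequality and a lower bound for the eigenvalues\<close>

lemma has_vector_derivative_partial:
  fixes f :: "real^2 \<Rightarrow> 'b::real_normed_vector"
  assumes "f differentiable (at (x + t *\<^sub>R axis i 1))"
  shows "((\<lambda>t. f (x + t *\<^sub>R axis i 1)) has_vector_derivative partial i f (x + t *\<^sub>R axis i 1)) (at t)"
proof -
  obtain D where D: "(f has_derivative D) (at (x + t *\<^sub>R axis i 1))"
    using assms by (auto simp: differentiable_def)
  \<comment> \<open>Base point \<open>y\<close> and parameter \<open>r\<close> are left free so that
    one computation serves twice: \<open>r = 0\<close> evaluates \<open>partial\<close>, and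
    \<open>y = x\<close> gives the derivative at \<open>t\<close>.\<close>
  have *: "((\<lambda>u. f (y + u *\<^sub>R axis i 1)) has_vector_derivative D (axis i 1)) (at r)"
    if "y + r *\<^sub>R axis i 1 = x + t *\<^sub>R axis i 1" for y r
  proof -
    have "((\<lambda>u. y + u *\<^sub>R axis i 1) has_derivative (\<lambda>u. u *\<^sub>R axis i 1)) (at r)"
      by (auto intro!: derivative_eq_intros)
    from has_derivative_compose[OF this] D that
    have "((\<lambda>u. f (y + u *\<^sub>R axis i 1)) has_derivative (\<lambda>u. D (u *\<^sub>R axis i 1))) (at r)"
      by simp
    then show ?thesis
      using D by (simp add: has_vector_derivative_def linear_cmul has_derivative_linear)
  qed
  have "partial i f (x + t *\<^sub>R axis i 1) = D (axis i 1)"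
    unfolding partial_def by (rule vector_derivative_at) (rule *, simp)
  then show ?thesis using *[of x t] by simp
qed

lemma partial_eqI:
  assumes "((\<lambda>t. f (x + t *\<^sub>R axis i 1)) has_vector_derivative d) (at 0)"
  shows "partial i f x = d"
  unfolding partial_def by (rule vector_derivative_at[OF assms])

lemma partial_mult:
  fixes f g :: "real^2 \<Rightarrow> real"
  assumes "f differentiable (at x)" "g differentiable (at x)"
  shows "partial i (\<lambda>x. f x * g x) x = f x * partial i g x + partial i f x * g x"
proof (rule partial_eqI)
  show "((\<lambda>t. f (x + t *\<^sub>R axis i 1) * g (x + t *\<^sub>R axis i 1)) has_vector_derivative
    f x * partial i g x + partial i f x * g x) (at 0)"
    using has_vector_derivative_mult[OF has_vector_derivative_partial[of f x 0 i]
        has_vector_derivative_partial[of g x 0 i]] assms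
    by simp
qed

text \<open>\<open>smooth_on_open\<close> quantifies over all lists of directions, so an inner
  derivative is absorbed by a longer list; hence derivatives of smooth functions are smooth.\<close>

lemma foldr_snoc_partial: "foldr partial is (partial i f) = foldr partial (is @ [i]) f"
  by simp

lemma test_functions_differentiable:
  assumes "\<psi> \<in> test_functions \<Omega>"
  shows "\<psi> differentiable (at x)"
proof -
  have "foldr partial [] \<psi> differentiable (at x)"
    using assms unfolding test_functions_def smooth_on_open_def by blast
  then show ?thesis by simp
qed

lemma test_functions_zero:
  "\<psi> \<in> test_functions \<Omega> \<Longrightarrow> x \<notin> \<Omega> \<Longrightarrow> \<psi> x = 0"
  unfolding test_functions_def using closure_subset[of "{x. \<psi> x \<noteq> 0}"] by blast

lemma test_functions_continuous: "\<psi> \<in> test_functions \<Omega> \<Longrightarrow> continuous_on UNIV \<psi>"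
  by (simp add: continuous_at_imp_continuous_on differentiable_imp_continuous_within test_functions_differentiable)

lemma partial_test_functions:
  assumes "\<psi> \<in> test_functions \<Omega>"
  shows "partial i \<psi> \<in> test_functions \<Omega>"
proof -
  let ?S = "closure {x. \<psi> x \<noteq> 0}"
  have "partial i \<psi> x = 0" if "x \<notin> ?S" for x
  proof (rule partial_eqI)
    \<comment> \<open>Off the closed support the function vanishes on a whole ball, hence so does
      its derivative at the centre.\<close>
    have "open (- ?S)" by auto
    moreover have "x \<in> - ?S" using that by simp
    ultimately obtain e where e: "e > 0" "ball x e \<subseteq> - ?S" by (rule openE)
    have z: "\<psi> y = 0" if "y \<in> ball x e" for y
      using e that closure_subset[of "{x. \<psi> x \<noteq> 0}"] by blast
    have "((\<lambda>t. 0::real) has_vector_derivative 0) (at (0::real))" by auto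
    then show "((\<lambda>t. \<psi> (x + t *\<^sub>R axis i 1)) has_vector_derivative 0) (at 0)"
    proof (rule has_vector_derivative_transform_within_open[where S="ball 0 e"])
      show "0 = \<psi> (x + t *\<^sub>R axis i 1)" if "t \<in> ball 0 e" for t
        using that by (intro z[symmetric]) (simp add: dist_norm norm_axis_1)
    qed (use e in auto)
  qed
  then have "{x. partial i \<psi> x \<noteq> 0} \<subseteq> ?S" by blast
  then have sub: "closure {x. partial i \<psi> x \<noteq> 0} \<subseteq> ?S" by (simp add: closure_minimal)
  moreover have "compact (closure {x. partial i \<psi> x \<noteq> 0})"
    using compact_Int_closed[of ?S "closure {x. partial i \<psi> x \<noteq> 0}"] assms sub
    by (simp add: test_functions_def inf.absorb2)
  moreover have "smooth_on_open UNIV (partial i \<psi>)"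
    using assms unfolding test_functions_def smooth_on_open_def foldr_snoc_partial by blast
  ultimately show ?thesis
    using assms unfolding test_functions_def by blast
qed

text \<open>Translation invariance of Lebesgue measure makes the integral of every difference
  quotient 0. The mean value inequality bounds the quotients uniformly on a fixed ball, and
  dominated convergence passes to the derivative. No iterated integrals are involved.\<close>

lemma integral_partial_eq_0:
  fixes f :: "real^2 \<Rightarrow> real"
  assumes df: "\<And>x. f differentiable (at x)" and cp: "continuous_on UNIV (partial i f)"
    and bd: "bounded {x. f x \<noteq> 0}"
  shows "integral\<^sup>L lborel (partial i f) = 0"
proof -
  let ?e = "axis i 1 :: real^2"
  have cf: "continuous_on UNIV f"
    by (simp add: continuous_at_imp_continuous_on differentiable_imp_continuous_within df)
  have [measurable]: "f \<in> borel_measurable borel" "partial i f \<in> borel_measurable borel"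
    using cf cp by (auto intro: borel_measurable_continuous_onI)
  obtain R where R: "\<And>x. f x \<noteq> 0 \<Longrightarrow> norm x \<le> R"
    using bd by (auto simp: bounded_iff)
  \<comment> \<open>The quotients vanish outside radius \<open>R + 1\<close>, and a step of length
    at most 1 from there stays within \<open>R + 2\<close>. For a negative \<open>R\<close> this
    ball may be empty, whence the \<open>max\<close> with 0 in \<open>B\<close>.\<close>
  have "compact (partial i f ` cball 0 (R + 2))"
    by (intro compact_continuous_image continuous_on_subset[OF cp]) auto
  then have "bounded (partial i f ` cball 0 (R + 2))" by (rule compact_imp_bounded)
  then obtain B0 where "\<forall>y\<in>partial i f ` cball 0 (R + 2). norm y \<le> B0"
    unfolding bounded_iff by blast
  then have B0: "\<And>x. x \<in> cball 0 (R + 2) \<Longrightarrow> norm (partial i f x) \<le> B0" by simp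
  define B where "B = max B0 0"
  have B: "\<And>x. x \<in> cball 0 (R + 2) \<Longrightarrow> norm (partial i f x) \<le> B" "0 \<le> B"
    using B0 by (force simp: B_def)+
  define h where "h n = 1 / real (Suc n)" for n
  have h: "0 < h n" "h n \<le> 1" for n by (auto simp: h_def)
  define q where "q n x = (f (x + h n *\<^sub>R ?e) - f x) / h n" for n x
  have int0: "integral\<^sup>L lborel (q n) = 0" for n
  proof -
    have i1: "integrable lborel f"
    proof -
      have "integrable lborel (\<lambda>x. indicator (cball 0 R) x *\<^sub>R f x)"
        by (rule borel_integrable_compact) (auto intro: continuous_on_subset[OF cf])
      moreover have "(\<lambda>x. indicator (cball 0 R) x *\<^sub>R f x) = f"
        using R by (auto simp: fun_eq_iff indicator_def)
      ultimately show ?thesis by simp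
    qed
    have d: "lborel = distr lborel borel ((+) (h n *\<^sub>R ?e))" by (rule lborel_distr_plus[symmetric])
    have i2: "integrable lborel (\<lambda>x. f (h n *\<^sub>R ?e + x))"
      using i1 by (subst (asm) d) (simp add: integrable_distr_eq)
    have e2: "integral\<^sup>L lborel (\<lambda>x. f (h n *\<^sub>R ?e + x)) = integral\<^sup>L lborel f"
      by (subst (2) d) (simp add: integral_distr)
    have "integral\<^sup>L lborel (\<lambda>x. f (h n *\<^sub>R ?e + x) - f x) = 0"
      using i1 i2 e2 by simp
    then show ?thesis unfolding q_def by (simp add: add.commute)
  qed
  have "(\<lambda>n. integral\<^sup>L lborel (q n)) \<longlonglongrightarrow> integral\<^sup>L lborel (partial i f)"
  proof (rule integral_dominated_convergence)
    show "integrable lborel (\<lambda>x. indicator (cball 0 (R + 1)) x *\<^sub>R B)"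
      by (rule borel_integrable_compact) auto
    show "AE x in lborel. (\<lambda>n. q n x) \<longlonglongrightarrow> partial i f x"
    proof (rule AE_I2)
      fix x
      have "((\<lambda>t. f (x + t *\<^sub>R ?e)) has_vector_derivative partial i f x) (at 0)"
        using has_vector_derivative_partial[OF df, of x i 0] by simp
      then have "((\<lambda>t. (f (x + t *\<^sub>R ?e) - f x) / t) \<longlongrightarrow> partial i f x) (at 0)"
        by (simp add: has_real_derivative_iff_has_vector_derivative[symmetric] DERIV_def)
      moreover have "filterlim h (at 0) sequentially"
        unfolding filterlim_at h_def using LIMSEQ_inverse_real_of_nat by (auto simp: inverse_eq_divide)
      ultimately show "(\<lambda>n. q n x) \<longlonglongrightarrow> partial i f x"
        unfolding q_def by (rule filterlim_compose)
    qed
    show "AE x in lborel. norm (q n x) \<le> indicator (cball 0 (R + 1)) x *\<^sub>R B" for n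
    proof (rule AE_I2)
      fix x
      have nh: "norm (t *\<^sub>R ?e) \<le> 1" if "0 \<le> t" "t \<le> h n" for t
        using that h[of n] by (simp add: norm_axis_1)
      show "norm (q n x) \<le> indicator (cball 0 (R + 1)) x *\<^sub>R B"
      proof (cases "x \<in> cball 0 (R + 1)")
        case True
        have "norm (f (x + h n *\<^sub>R ?e) - f (x + 0 *\<^sub>R ?e)) \<le> B * norm (h n - 0)"
        proof (rule differentiable_bound[where S="{0..h n}" and f'="\<lambda>t r. r *\<^sub>R partial i f (x + t *\<^sub>R ?e)"])
          fix t assume t: "t \<in> {0..h n}"
          show "((\<lambda>t. f (x + t *\<^sub>R ?e)) has_derivative (\<lambda>r. r *\<^sub>R partial i f (x + t *\<^sub>R ?e))) (at t within {0..h n})"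
            using has_vector_derivative_partial[OF df, of x i t]
            by (simp add: has_vector_derivative_def has_derivative_at_withinI)
          have "norm (x + t *\<^sub>R ?e) \<le> R + 2"
            using norm_triangle_ineq[of x "t *\<^sub>R ?e"] nh[of t] True t by simp
          then have "norm (partial i f (x + t *\<^sub>R ?e)) \<le> B" by (intro B) simp
          then show "onorm (\<lambda>r. r *\<^sub>R partial i f (x + t *\<^sub>R ?e)) \<le> B"
            by (intro onorm_le) (simp add: abs_mult mult_left_mono mult.commute[of B])
        qed (use h[of n] in auto)
        then show ?thesis using True h[of n] by (simp add: q_def field_simps)
      next
        case False
        have "f x = 0" using False R[of x] by auto
        moreover have "f (x + h n *\<^sub>R ?e) = 0"
        proof (rule ccontr)
          assume "f (x + h n *\<^sub>R ?e) \<noteq> 0"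
          then have "norm (x + h n *\<^sub>R ?e) \<le> R" by (rule R)
          moreover have "norm x \<le> norm (x + h n *\<^sub>R ?e) + norm (h n *\<^sub>R ?e)"
            using norm_triangle_ineq4[of "x + h n *\<^sub>R ?e" "h n *\<^sub>R ?e"] by simp
          ultimately show False using False nh[of "h n"] h(1)[of n] by simp
        qed
        ultimately show ?thesis by (simp add: q_def B(2))
      qed
    qed
    have [measurable]: "(\<lambda>x. f (x + h n *\<^sub>R ?e)) \<in> borel_measurable borel" for n
      by (intro borel_measurable_continuous_onI continuous_on_compose2[OF cf] continuous_intros) auto
    show "q n \<in> borel_measurable lborel" for n unfolding q_def by measurable
  qed simp
  then show ?thesis using int0 by (simp add: LIMSEQ_const_iff)
qed

text \<open>Links the restricted measure used in the definitions with \<open>lborel\<close>, on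
  which translations were available.\<close>

lemma integral_lebesgue_on_eq_lborel:
  fixes h :: "real^2 \<Rightarrow> real"
  assumes "h \<in> borel_measurable borel" "\<Omega> \<in> sets lebesgue" "\<And>x. x \<notin> \<Omega> \<Longrightarrow> h x = 0"
  shows "integral\<^sup>L (lebesgue_on \<Omega>) h = integral\<^sup>L lborel h"
proof -
  have "(\<lambda>x. indicator \<Omega> x *\<^sub>R h x) = h"
    using assms(3) by (auto simp: fun_eq_iff indicator_def)
  then have "integral\<^sup>L (lebesgue_on \<Omega>) h = integral\<^sup>L lebesgue h"
    using assms(2) by (simp add: integral_restrict_space)
  also have "\<dots> = integral\<^sup>L lborel h" using assms(1) by (intro integral_completion) simp
  finally show ?thesis .
qed

lemma L2_continuous:
  assumes "\<Omega> \<in> lmeasurable" "bounded \<Omega>" "continuous_on UNIV f"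
  shows "f \<in> L2 \<Omega>"
proof -
  have "compact (f ` closure \<Omega>)"
    using assms by (intro compact_continuous_image continuous_on_subset[OF assms(3)]) auto
  then have "bounded (f ` closure \<Omega>)" by (rule compact_imp_bounded)
  then obtain B where "\<forall>y\<in>f ` closure \<Omega>. norm y \<le> B"
    unfolding bounded_iff by blast
  then have "\<And>x. x \<in> \<Omega> \<Longrightarrow> \<bar>f x\<bar> \<le> B"
    using closure_subset[of \<Omega>] by auto
  moreover have "f \<in> borel_measurable (lebesgue_on \<Omega>)"
    using assms(3) by (intro measurable_restrict_space1 measurable_completion) (simp add: borel_measurable_continuous_onI)
  ultimately show ?thesis using L2_bounded(1)[OF assms(1)] by blast
qed

text \<open>By the product rule the sum of the two integrands is the derivative of
  \<open>f * g\<close>, whose support is confined to \<open>\<Omega>\<close> by \<open>g\<close>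
  alone; its integral over the plane is 0.\<close>

lemma L2_integration_by_parts:
  assumes Om: "\<Omega> \<in> lmeasurable" "bounded \<Omega>"
    and f: "\<And>x. f differentiable (at x)" "continuous_on UNIV (partial i f)"
    and g: "g \<in> test_functions \<Omega>"
  shows "L2_inner \<Omega> f (partial i g) = - L2_inner \<Omega> (partial i f) g"
proof -
  have cf: "continuous_on UNIV f"
    by (simp add: continuous_at_imp_continuous_on differentiable_imp_continuous_within f)
  have cg: "continuous_on UNIV g" "continuous_on UNIV (partial i g)"
    using test_functions_continuous g partial_test_functions by blast+
  have dg: "\<And>x. g differentiable (at x)" using g by (rule test_functions_differentiable)
  have eq: "partial i (\<lambda>x. f x * g x) = (\<lambda>x. f x * partial i g x + partial i f x * g x)"
    using partial_mult[OF f(1) dg] by blast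
  have c: "continuous_on UNIV (\<lambda>x. f x * partial i g x + partial i f x * g x)"
    by (intro continuous_intros cf cg f)
  have "integral\<^sup>L lborel (partial i (\<lambda>x. f x * g x)) = 0"
  proof (rule integral_partial_eq_0)
    show "(\<lambda>x. f x * g x) differentiable (at x)" for x using f(1) dg by (rule differentiable_mult)
    show "continuous_on UNIV (partial i (\<lambda>x. f x * g x))" unfolding eq by (rule c)
    show "bounded {x. f x * g x \<noteq> 0}"
      by (rule bounded_subset[OF Om(2)]) (use test_functions_zero[OF g] in auto)
  qed
  then have "integral\<^sup>L lborel (\<lambda>x. f x * partial i g x + partial i f x * g x) = 0"
    unfolding eq .
  moreover have "integral\<^sup>L (lebesgue_on \<Omega>) (\<lambda>x. f x * partial i g x + partial i f x * g x)
      = integral\<^sup>L lborel (\<lambda>x. f x * partial i g x + partial i f x * g x)"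
  proof (rule integral_lebesgue_on_eq_lborel)
    show "(\<lambda>x. f x * partial i g x + partial i f x * g x) \<in> borel_measurable borel"
      using c by (rule borel_measurable_continuous_onI)
    show "f x * partial i g x + partial i f x * g x = 0" if "x \<notin> \<Omega>" for x
      using test_functions_zero[OF g that] test_functions_zero[OF partial_test_functions[OF g] that] by simp
  qed (use Om in auto)
  moreover have "integrable (lebesgue_on \<Omega>) (\<lambda>x. f x * partial i g x)"
    "integrable (lebesgue_on \<Omega>) (\<lambda>x. partial i f x * g x)"
    by (intro L2_mult_integrable L2_continuous Om cf cg f)+
  ultimately have "(\<integral>x. f x * partial i g x \<partial>lebesgue_on \<Omega>) + (\<integral>x. partial i f x * g x \<partial>lebesgue_on \<Omega>) = 0"
    by simp
  then show ?thesis unfolding L2_inner_def by linarith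
qed

text \<open>Both Poincare arguments end with a squared norm on the left and the same norm as a
  factor on the right; the factor may be 0.\<close>

lemma L2_norm_le_of_square:
  assumes "(L2_norm \<Omega> f)\<^sup>2 \<le> B * L2_norm \<Omega> f" "0 \<le> B"
  shows "L2_norm \<Omega> f \<le> B"
proof (cases "L2_norm \<Omega> f = 0")
  case False
  then have "0 < L2_norm \<Omega> f" using L2_norm_nonneg[of \<Omega> f] by simp
  then show ?thesis using assms(1) unfolding power2_eq_square by (rule mult_right_le_imp_le[rotated])
qed (use assms(2) in simp)

text \<open>The coordinate \<open>x $ 1\<close> has derivative 1 in direction 1 and is bounded by
  \<open>R\<close> on the domain. Integrating its derivative against the square of
  \<open>\<psi>\<close> by parts gives -2 times the inner product of \<open>x $ 1 * \<psi> x\<close>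
  and \<open>partial 1 \<psi>\<close>, to which Cauchy-Schwarz applies.\<close>

lemma Poincare_test_functions:
  assumes Om: "\<Omega> \<in> lmeasurable" "\<And>x. x \<in> \<Omega> \<Longrightarrow> norm x \<le> R" "0 \<le> R"
    and \<psi>: "\<psi> \<in> test_functions \<Omega>"
  shows "L2_norm \<Omega> \<psi> \<le> 2 * R * L2_norm \<Omega> (partial 1 \<psi>)"
proof (rule L2_norm_le_of_square)
  have bd: "bounded \<Omega>" using Om(2) by (auto simp: bounded_iff)
  let ?d = "partial 1 \<psi>" and ?x\<psi> = "\<lambda>x. x $ 1 * \<psi> x"
  have d\<psi>: "\<And>x. \<psi> differentiable (at x)" using \<psi> by (rule test_functions_differentiable)
  have c: "continuous_on UNIV \<psi>" "continuous_on UNIV ?d"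
    using test_functions_continuous \<psi> partial_test_functions by blast+
  have cx: "continuous_on UNIV ?x\<psi>" "continuous_on UNIV (\<lambda>x. x $ 1 * ?d x)"
    by (intro continuous_intros c)+
  note L = L2_continuous[OF Om(1) bd]
  have dx: "(\<lambda>x. x $ 1) differentiable (at x)" for x :: "real^2"
    by (intro linear_imp_differentiable) (simp add: linear_iff)
  have p1: "partial 1 (\<lambda>x. x $ 1) x = 1" for x :: "real^2"
    by (rule partial_eqI) (auto intro!: derivative_eq_intros simp: has_real_derivative_iff_has_vector_derivative[symmetric] axis_def)
  have px: "partial 1 ?x\<psi> = (\<lambda>x. x $ 1 * ?d x + \<psi> x)"
    using partial_mult[OF dx d\<psi>, of 1] p1 by fastforce
  have "L2_inner \<Omega> ?x\<psi> ?d = - L2_inner \<Omega> (partial 1 ?x\<psi>) \<psi>"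
  proof (rule L2_integration_by_parts[OF Om(1) bd _ _ \<psi>])
    show "?x\<psi> differentiable (at x)" for x using dx d\<psi> by (rule differentiable_mult)
    show "continuous_on UNIV (partial 1 ?x\<psi>)" unfolding px by (intro continuous_intros c)
  qed
  also have "L2_inner \<Omega> (partial 1 ?x\<psi>) \<psi> = L2_inner \<Omega> (\<lambda>x. x $ 1 * ?d x) \<psi> + L2_inner \<Omega> \<psi> \<psi>"
    unfolding px using L c cx by (intro L2_inner_add_left) auto
  \<comment> \<open>The term on the left reappears on the right; collecting the two copies produces
    the factor 2.\<close>
  also have "L2_inner \<Omega> (\<lambda>x. x $ 1 * ?d x) \<psi> = L2_inner \<Omega> ?x\<psi> ?d"
    by (simp add: L2_inner_def mult.commute mult.left_commute)
  finally have "(L2_norm \<Omega> \<psi>)\<^sup>2 = - 2 * L2_inner \<Omega> ?x\<psi> ?d"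
    by (simp add: L2_norm_sq)
  also have "\<dots> \<le> 2 * (L2_norm \<Omega> ?x\<psi> * L2_norm \<Omega> ?d)"
    using L2_Cauchy_Schwarz[OF L[OF cx(1)] L[OF c(2)]] by linarith
  also have "L2_norm \<Omega> ?x\<psi> \<le> R * L2_norm \<Omega> \<psi>"
  proof (rule power2_le_imp_le)
    have "L2_inner \<Omega> ?x\<psi> ?x\<psi> \<le> (\<integral>x. R\<^sup>2 * (\<psi> x * \<psi> x) \<partial>lebesgue_on \<Omega>)"
      unfolding L2_inner_def
    proof (rule integral_mono)
      show "integrable (lebesgue_on \<Omega>) (\<lambda>x. ?x\<psi> x * ?x\<psi> x)"
        "integrable (lebesgue_on \<Omega>) (\<lambda>x. R\<^sup>2 * (\<psi> x * \<psi> x))"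
        using L cx c by (auto intro!: L2_mult_integrable)
      fix x assume "x \<in> space (lebesgue_on \<Omega>)"
      then have "\<bar>x $ 1\<bar> \<le> R" using Om(2)[of x] component_le_norm_cart[of x 1] by simp
      then have "(x $ 1)\<^sup>2 \<le> R\<^sup>2" by (metis abs_ge_zero power2_abs power_mono)
      then have "(x $ 1)\<^sup>2 * (\<psi> x)\<^sup>2 \<le> R\<^sup>2 * (\<psi> x)\<^sup>2" by (rule mult_right_mono) simp
      then show "?x\<psi> x * ?x\<psi> x \<le> R\<^sup>2 * (\<psi> x * \<psi> x)"
        by (simp add: power2_eq_square mult.assoc mult.left_commute)
    qed
    then show "(L2_norm \<Omega> ?x\<psi>)\<^sup>2 \<le> (R * L2_norm \<Omega> \<psi>)\<^sup>2"
      by (simp add: power_mult_distrib L2_norm_sq) (simp add: L2_inner_def)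
    show "0 \<le> R * L2_norm \<Omega> \<psi>" using Om(3) by (simp add: L2_norm_nonneg)
  qed
  then have "2 * (L2_norm \<Omega> ?x\<psi> * L2_norm \<Omega> ?d) \<le> 2 * (R * L2_norm \<Omega> \<psi> * L2_norm \<Omega> ?d)"
    by (intro mult_left_mono mult_right_mono) (auto simp: L2_norm_nonneg)
  finally show "(L2_norm \<Omega> \<psi>)\<^sup>2 \<le> 2 * R * L2_norm \<Omega> ?d * L2_norm \<Omega> \<psi>"
    by (simp add: algebra_simps)
  show "0 \<le> 2 * R * L2_norm \<Omega> ?d" using Om(3) by (simp add: L2_norm_nonneg)
qed

section \<open>Weak gradients, coercivity and the lowest eigenvalue\<close>

lemma weak_grad_component:
  assumes "\<And>i. \<exists>g\<in>L2 \<Omega>. is_weak_partial \<Omega> i u g"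
  shows "(\<lambda>x. weak_grad \<Omega> u x $ i) \<in> L2 \<Omega>" "is_weak_partial \<Omega> i u (\<lambda>x. weak_grad \<Omega> u x $ i)"
proof -
  have "\<exists>g. g \<in> L2 \<Omega> \<and> is_weak_partial \<Omega> i u g" using assms by blast
  from someI_ex[OF this]
  show "(\<lambda>x. weak_grad \<Omega> u x $ i) \<in> L2 \<Omega>" "is_weak_partial \<Omega> i u (\<lambda>x. weak_grad \<Omega> u x $ i)"
    by (simp_all add: weak_grad_def)
qed

lemma norm_vec2_sq: "(norm (v :: real^2))\<^sup>2 = (v $ 1)\<^sup>2 + (v $ 2)\<^sup>2"
  unfolding power2_norm_eq_inner by (simp add: inner_vec_def sum_2 power2_eq_square)

lemma weak_grad_norm_ge:
  assumes "\<And>i. \<exists>g\<in>L2 \<Omega>. is_weak_partial \<Omega> i u g"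
  shows "integrable (lebesgue_on \<Omega>) (\<lambda>x. (norm (weak_grad \<Omega> u x))\<^sup>2)"
    and "L2_inner \<Omega> (\<lambda>x. weak_grad \<Omega> u x $ 1) (\<lambda>x. weak_grad \<Omega> u x $ 1)
      \<le> integral\<^sup>L (lebesgue_on \<Omega>) (\<lambda>x. (norm (weak_grad \<Omega> u x))\<^sup>2)"
proof -
  have i: "integrable (lebesgue_on \<Omega>) (\<lambda>x. (weak_grad \<Omega> u x $ i)\<^sup>2)" for i
    using weak_grad_component(1)[OF assms, of i] by (simp add: L2_def)
  show 1: "integrable (lebesgue_on \<Omega>) (\<lambda>x. (norm (weak_grad \<Omega> u x))\<^sup>2)"
    unfolding norm_vec2_sq using i by auto
  show "L2_inner \<Omega> (\<lambda>x. weak_grad \<Omega> u x $ 1) (\<lambda>x. weak_grad \<Omega> u x $ 1)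
      \<le> integral\<^sup>L (lebesgue_on \<Omega>) (\<lambda>x. (norm (weak_grad \<Omega> u x))\<^sup>2)"
    unfolding L2_inner_def
    by (rule integral_mono) (use i[of 1] 1 in \<open>auto simp: norm_vec2_sq power2_eq_square[symmetric]\<close>)
qed

text \<open>Uniqueness of weak derivatives is avoided: the derivative of the approximating test function is
  itself a test function, so testing with it bounds its norm by that of any weak derivative.\<close>

lemma Poincare_H10:
  assumes Om: "\<Omega> \<in> lmeasurable" "\<And>x. x \<in> \<Omega> \<Longrightarrow> norm x \<le> R" "0 \<le> R"
    and u: "u \<in> H10 \<Omega>" and g: "g \<in> L2 \<Omega>" "is_weak_partial \<Omega> 1 u g"
  shows "L2_norm \<Omega> u \<le> 2 * R * L2_norm \<Omega> g"
proof -
  have bd: "bounded \<Omega>" using Om(2) by (auto simp: bounded_iff)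
  have u2: "u \<in> L2 \<Omega>" and uw: "\<And>i. \<exists>g\<in>L2 \<Omega>. is_weak_partial \<Omega> i u g"
    using u by (auto simp: H10_def H1_def)
  note L = L2_continuous[OF Om(1) bd test_functions_continuous]
  have eps: "L2_norm \<Omega> u \<le> 2 * R * L2_norm \<Omega> g + (1 + 2 * R) * e" if e: "e > 0" for e
  proof -
    obtain \<psi> where \<psi>: "\<psi> \<in> test_functions \<Omega>" and le: "H1_norm \<Omega> (\<lambda>x. u x - \<psi> x) < e"
      using u e by (auto simp: H10_def)
    let ?w = "\<lambda>x. u x - \<psi> x"
    have ibp: "L2_inner \<Omega> \<psi> (partial i \<eta>) = - L2_inner \<Omega> (partial i \<psi>) \<eta>" if "\<eta> \<in> test_functions \<Omega>" for \<eta> i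
      by (rule L2_integration_by_parts[OF Om(1) bd _ _ that])
        (auto intro: test_functions_differentiable test_functions_continuous partial_test_functions \<psi>)
    \<comment> \<open>\<open>H1_norm\<close> of the difference involves the chosen
      \<open>weak_grad\<close> of the difference, which is not known to be a difference of
      gradients; existence of weak derivatives of \<open>?w\<close> is what makes that choice
      meaningful.\<close>
    have w: "\<exists>g\<in>L2 \<Omega>. is_weak_partial \<Omega> i ?w g" for i
    proof -
      obtain gi where gi: "gi \<in> L2 \<Omega>" "is_weak_partial \<Omega> i u gi" using uw by blast
      have "is_weak_partial \<Omega> i ?w (\<lambda>x. gi x - partial i \<psi> x)"
        unfolding is_weak_partial_def
      proof
        fix \<eta> assume \<eta>: "\<eta> \<in> test_functions \<Omega>"
        have "L2_inner \<Omega> ?w (partial i \<eta>) = L2_inner \<Omega> u (partial i \<eta>) - L2_inner \<Omega> \<psi> (partial i \<eta>)"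
          by (rule L2_inner_diff_left[OF u2 L[OF \<psi>] L[OF partial_test_functions[OF \<eta>]]])
        also have "\<dots> = - (L2_inner \<Omega> gi \<eta> - L2_inner \<Omega> (partial i \<psi>) \<eta>)"
          using gi(2) \<eta> ibp[OF \<eta>] by (simp add: is_weak_partial_def)
        also have "L2_inner \<Omega> gi \<eta> - L2_inner \<Omega> (partial i \<psi>) \<eta> = L2_inner \<Omega> (\<lambda>x. gi x - partial i \<psi> x) \<eta>"
          by (rule L2_inner_diff_left[OF gi(1) L[OF partial_test_functions[OF \<psi>]] L[OF \<eta>], symmetric])
        finally show "L2_inner \<Omega> ?w (partial i \<eta>) = - L2_inner \<Omega> (\<lambda>x. gi x - partial i \<psi> x) \<eta>" .
      qed
      moreover have "(\<lambda>x. gi x - partial i \<psi> x) \<in> L2 \<Omega>"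
        by (rule L2_diff[OF gi(1) L[OF partial_test_functions[OF \<psi>]]])
      ultimately show ?thesis by blast
    qed
    define h where "h = (\<lambda>x. weak_grad \<Omega> ?w x $ 1)"
    have h: "h \<in> L2 \<Omega>" "is_weak_partial \<Omega> 1 ?w h"
      using weak_grad_component[OF w, of 1] unfolding h_def by auto
    have "L2_norm \<Omega> h \<le> H1_norm \<Omega> ?w"
      unfolding L2_norm_def H1_norm_def
      using weak_grad_norm_ge(2)[OF w] L2_inner_self_nonneg[of \<Omega> ?w]
      by (intro real_sqrt_le_mono) (simp add: h_def)
    then have he: "L2_norm \<Omega> h \<le> e" using le by simp
    have "L2_norm \<Omega> ?w \<le> H1_norm \<Omega> ?w"
      unfolding L2_norm_def H1_norm_def by (intro real_sqrt_le_mono) simp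
    then have we: "L2_norm \<Omega> ?w \<le> e" using le by simp
    let ?d = "partial 1 \<psi>"
    have d: "?d \<in> test_functions \<Omega>" by (rule partial_test_functions[OF \<psi>])
    have "L2_norm \<Omega> ?d \<le> L2_norm \<Omega> g + L2_norm \<Omega> h"
    proof (rule L2_norm_le_of_square)
      \<comment> \<open>With \<open>?d\<close> as test function, the three pairings with
        \<open>partial 1 ?d\<close> turn into minus the pairings of \<open>h\<close>,
        \<open>g\<close> and \<open>?d\<close> with \<open>?d\<close>; solving for the last one
        gives its squared norm.\<close>
      have "L2_inner \<Omega> ?w (partial 1 ?d) = L2_inner \<Omega> u (partial 1 ?d) - L2_inner \<Omega> \<psi> (partial 1 ?d)"
        by (rule L2_inner_diff_left[OF u2 L[OF \<psi>] L[OF partial_test_functions[OF d]]])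
      then have "L2_inner \<Omega> ?d ?d = L2_inner \<Omega> g ?d - L2_inner \<Omega> h ?d"
        using h(2) g(2) d ibp[OF d, of 1] by (simp add: is_weak_partial_def)
      also have "\<dots> \<le> L2_norm \<Omega> g * L2_norm \<Omega> ?d + L2_norm \<Omega> h * L2_norm \<Omega> ?d"
        using L2_Cauchy_Schwarz[OF g(1) L[OF d]] L2_Cauchy_Schwarz[OF h(1) L[OF d]] by linarith
      finally show "(L2_norm \<Omega> ?d)\<^sup>2 \<le> (L2_norm \<Omega> g + L2_norm \<Omega> h) * L2_norm \<Omega> ?d"
        by (simp add: L2_norm_sq algebra_simps)
    qed (simp add: L2_norm_nonneg)
    then have "2 * R * L2_norm \<Omega> ?d \<le> 2 * R * (L2_norm \<Omega> g + e)"
      using he Om(3) by (intro mult_left_mono) auto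
    then have p: "L2_norm \<Omega> \<psi> \<le> 2 * R * (L2_norm \<Omega> g + e)"
      using Poincare_test_functions[OF Om \<psi>] by linarith
    have "L2_norm \<Omega> (\<lambda>x. \<psi> x - (\<psi> x - u x)) \<le> L2_norm \<Omega> \<psi> + L2_norm \<Omega> (\<lambda>x. \<psi> x - u x)"
      by (rule L2_norm_triangle[OF L[OF \<psi>] L2_diff[OF L[OF \<psi>] u2]])
    moreover have "L2_norm \<Omega> (\<lambda>x. \<psi> x - u x) = L2_norm \<Omega> ?w"
      by (simp add: L2_norm_def L2_inner_def algebra_simps)
    ultimately show ?thesis using p we by (simp add: algebra_simps)
  qed
  show ?thesis
  proof (rule field_le_epsilon)
    fix e :: real assume "e > 0"
    moreover have "1 + 2 * R > 0" using Om(3) by simp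
    ultimately show "L2_norm \<Omega> u \<le> 2 * R * L2_norm \<Omega> g + e"
      using eps[of "e / (1 + 2 * R)"] by simp
  qed
qed

text \<open>The pointwise lower bound can be integrated once the energy density is known to be
  integrable, since a non-integrable function has integral 0 by convention. The case
  \<open>p = 0\<close> of the derivative bounds makes \<open>A\<close> essentially bounded, and its
  continuity makes it measurable.\<close>

lemma dirichlet_op_coercive:
  assumes "open \<Omega>" "analytic_coefficient \<Omega> A"
    and c: "\<And>x \<xi>. x \<in> \<Omega> \<Longrightarrow> c * (norm \<xi>)\<^sup>2 \<le> \<xi> \<bullet> (A x *v \<xi>)"
    and "u \<in> H1 \<Omega>"
  shows "c * integral\<^sup>L (lebesgue_on \<Omega>) (\<lambda>x. (norm (weak_grad \<Omega> u x))\<^sup>2) \<le> dirichlet_op \<Omega> A u u"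
proof -
  let ?w = "weak_grad \<Omega> u"
  have uw: "\<And>i. \<exists>g\<in>L2 \<Omega>. is_weak_partial \<Omega> i u g"
    using assms(4) by (auto simp: H1_def)
  note w = weak_grad_component(1)[OF uw]
  obtain C where "\<And>p. AE x in lebesgue_on \<Omega>. sum_derivs p A x \<le> C ^ (p + 1) * fact p"
    using assms(2) by (auto simp: analytic_coefficient_def)
  from this[of 0] have C: "AE x in lebesgue_on \<Omega>. norm (A x) \<le> C"
    by (simp add: sum_derivs_def)
  have "foldr partial [] A differentiable (at x)" if "x \<in> \<Omega>" for x
    using assms(2) that unfolding analytic_coefficient_def smooth_on_open_def by blast
  then have cA: "continuous_on \<Omega> A"
    by (simp add: continuous_at_imp_continuous_on differentiable_imp_continuous_within)
  have int: "integrable (lebesgue_on \<Omega>) (\<lambda>x. A x $ i $ j * (?w x $ j * ?w x $ i))" for i j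
  proof (rule Bochner_Integration.integrable_bound)
    show "integrable (lebesgue_on \<Omega>) (\<lambda>x. C * (?w x $ j * ?w x $ i))"
      by (intro integrable_mult_right L2_mult_integrable w)
    have "(\<lambda>x. A x $ i $ j) \<in> borel_measurable (lebesgue_on \<Omega>)"
      using assms(1) by (intro continuous_imp_measurable_on_sets_lebesgue continuous_intros cA) auto
    then show "(\<lambda>x. A x $ i $ j * (?w x $ j * ?w x $ i)) \<in> borel_measurable (lebesgue_on \<Omega>)"
      using L2_measurable[OF w[of i]] L2_measurable[OF w[of j]] by (intro borel_measurable_times)
    show "AE x in lebesgue_on \<Omega>. norm (A x $ i $ j * (?w x $ j * ?w x $ i)) \<le> norm (C * (?w x $ j * ?w x $ i))"
      using C
    proof eventually_elim
      case (elim x)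
      have "\<bar>A x $ i $ j\<bar> \<le> norm (A x)"
        using component_le_norm_cart[of "A x $ i" j] Finite_Cartesian_Product.norm_nth_le[of "A x" i] by linarith
      then have "\<bar>A x $ i $ j\<bar> \<le> \<bar>C\<bar>" using elim by linarith
      then show ?case by (simp add: abs_mult mult_right_mono)
    qed
  qed
  have eq: "(A x *v ?w x) \<bullet> ?w x = (\<Sum>i\<in>UNIV. \<Sum>j\<in>UNIV. A x $ i $ j * (?w x $ j * ?w x $ i))" for x
    by (simp add: inner_vec_def matrix_vector_mult_def sum_distrib_right mult.assoc)
  have "c * integral\<^sup>L (lebesgue_on \<Omega>) (\<lambda>x. (norm (?w x))\<^sup>2)
      = integral\<^sup>L (lebesgue_on \<Omega>) (\<lambda>x. c * (norm (?w x))\<^sup>2)"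
    by simp
  also have "\<dots> \<le> dirichlet_op \<Omega> A u u"
    unfolding dirichlet_op_def
  proof (rule integral_mono)
    show "integrable (lebesgue_on \<Omega>) (\<lambda>x. c * (norm (?w x))\<^sup>2)"
      using weak_grad_norm_ge(1)[OF uw] by simp
    show "integrable (lebesgue_on \<Omega>) (\<lambda>x. (A x *v ?w x) \<bullet> ?w x)"
      unfolding eq using int by (intro Bochner_Integration.integrable_sum)
    show "c * (norm (?w x))\<^sup>2 \<le> (A x *v ?w x) \<bullet> ?w x" if "x \<in> space (lebesgue_on \<Omega>)" for x
      using c[of x "?w x"] that by (simp add: inner_commute)
  qed
  finally show ?thesis .
qed

text \<open>Testing the eigenvalue equation with the normalised eigenfunction itself identifies
  \<open>lam k\<close> with its energy; coercivity and the Poincare inequality on a ball of radius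
  \<open>R\<close> give the bound \<open>c / (2 * R)\<^sup>2\<close>.\<close>

lemma dirichlet_eigenvalues_bounded_below:
  assumes "open \<Omega>" "bounded \<Omega>" "analytic_coefficient \<Omega> A" "uniformly_positive_definite \<Omega> A"
    and ev: "dirichlet_eigenbasis \<Omega> A lam \<phi>"
  shows "\<exists>c>0. \<forall>k. c \<le> lam k"
proof -
  have Om: "\<Omega> \<in> lmeasurable" using assms(1,2) by (rule lmeasurable_open[rotated])
  obtain R where R: "R > 0" "\<And>x. x \<in> \<Omega> \<Longrightarrow> norm x \<le> R"
    using assms(2) by (auto simp: bounded_pos)
  obtain c where c: "c > 0" "\<And>x \<xi>. x \<in> \<Omega> \<Longrightarrow> c * (norm \<xi>)\<^sup>2 \<le> \<xi> \<bullet> (A x *v \<xi>)"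
    using assms(4) by (auto simp: uniformly_positive_definite_def)
  have "c / (2 * R)\<^sup>2 \<le> lam k" for k
  proof -
    have k: "\<phi> k \<in> H10 \<Omega>" "dirichlet_op \<Omega> A (\<phi> k) (\<phi> k) = lam k" "L2_norm \<Omega> (\<phi> k) = 1"
      using ev by (auto simp: dirichlet_eigenbasis_def L2_norm_def)
    have w: "\<And>i. \<exists>g\<in>L2 \<Omega>. is_weak_partial \<Omega> i (\<phi> k) g"
      using k(1) by (auto simp: H10_def H1_def)
    let ?g = "\<lambda>x. weak_grad \<Omega> (\<phi> k) x $ 1"
    have "1 \<le> 2 * R * L2_norm \<Omega> ?g"
      using Poincare_H10[OF Om R(2) _ k(1) weak_grad_component[OF w]] R(1) k(3) by simp
    then have "1\<^sup>2 \<le> (2 * R * L2_norm \<Omega> ?g)\<^sup>2" by (intro power_mono) auto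
    then have "1 \<le> (2 * R)\<^sup>2 * L2_inner \<Omega> ?g ?g" by (simp add: power_mult_distrib L2_norm_sq)
    then have "c / (2 * R)\<^sup>2 \<le> c * L2_inner \<Omega> ?g ?g" using R(1) c(1) by (simp add: field_simps)
    also have "\<dots> \<le> c * integral\<^sup>L (lebesgue_on \<Omega>) (\<lambda>x. (norm (weak_grad \<Omega> (\<phi> k) x))\<^sup>2)"
      using weak_grad_norm_ge(2)[OF w] c(1) by simp
    also have "\<dots> \<le> lam k"
      using dirichlet_op_coercive[OF assms(1,3) c(2), of "\<phi> k"] k(1,2) by (simp add: H10_def)
    finally show ?thesis .
  qed
  then show ?thesis using c(1) R(1) by (intro exI[of _ "c / (2 * R)\<^sup>2"]) auto
qed

section \<open>Polynomial approximation of holomorphic functions\<close>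

definition cvec2 :: "complex \<Rightarrow> complex \<Rightarrow> complex^2" where
  "cvec2 z w = (\<chi> i. if i = 1 then z else w)"

lemma cvec2_nth [simp]: "cvec2 z w $ 1 = z" "cvec2 z w $ 2 = w"
  by (simp_all add: cvec2_def)

lemma of_real2_eq_cvec2: "of_real2 x = cvec2 (of_real (x $ 1)) (of_real (x $ 2))"
  by (simp add: of_real2_def vec_eq_iff forall_2)

lemma norm_cvec2_diff: "norm (cvec2 z w - cvec2 a b) \<le> norm (z - a) + norm (w - b)"
proof -
  have "norm (cvec2 z w - cvec2 a b) \<le> (\<Sum>i\<in>UNIV. norm ((cvec2 z w - cvec2 a b) $ i))"
    unfolding norm_vec_def by (rule L2_set_le_sum) simp
  then show ?thesis by (simp add: sum_2)
qed

text \<open>The derivative is written as a complex multiple of a fixed vector, the form on which the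
  complex homogeneity in \<open>holomorphic2_on\<close> acts.\<close>

lemma has_derivative_cvec2:
  "((\<lambda>z. cvec2 z w) has_derivative (\<lambda>h. h *s cvec2 1 0)) (at z)"
  "((\<lambda>w. cvec2 z w) has_derivative (\<lambda>h. h *s cvec2 0 1)) (at w)"
proof -
  have bl: "bounded_linear (\<lambda>h. h *s v)" for v :: "complex^2"
    unfolding linear_conv_bounded_linear[symmetric]
    by (rule linearI) (auto simp: vec_eq_iff algebra_simps)
  have d: "((\<lambda>h. c + h *s v) has_derivative (\<lambda>h. h *s v)) (at x)" for c v :: "complex^2" and x
    by (auto intro!: derivative_eq_intros bounded_linear.has_derivative[OF bl])
  have "(\<lambda>z. cvec2 z w) = (\<lambda>z. cvec2 0 w + z *s cvec2 1 0)"
    "(\<lambda>w. cvec2 z w) = (\<lambda>w. cvec2 z 0 + w *s cvec2 0 1)"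
    by (simp_all add: fun_eq_iff vec_eq_iff forall_2)
  then show "((\<lambda>z. cvec2 z w) has_derivative (\<lambda>h. h *s cvec2 1 0)) (at z)"
    "((\<lambda>w. cvec2 z w) has_derivative (\<lambda>h. h *s cvec2 0 1)) (at w)"
    using d by metis+
qed

lemma continuous_on_cvec2 [continuous_intros]:
  assumes "continuous_on S f" "continuous_on S g"
  shows "continuous_on S (\<lambda>x. cvec2 (f x) (g x))"
  unfolding cvec2_def
proof (intro continuous_intros)
  show "continuous_on S (\<lambda>x. if i = 1 then f x else g x)" for i :: 2
    using assms by (cases "i = 1") auto
qed

text \<open>By the chain rule a slice has derivative \<open>h \<mapsto> D (h *s v)\<close>; complex
  homogeneity turns this into multiplication by \<open>D v\<close>, that is, a complex
  derivative.\<close>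

lemma holomorphic2_on_slices:
  assumes "holomorphic2_on F G"
  shows "(\<And>z. z \<in> S \<Longrightarrow> cvec2 z w \<in> G) \<Longrightarrow> (\<lambda>z. F (cvec2 z w)) holomorphic_on S"
    and "(\<And>w. w \<in> S \<Longrightarrow> cvec2 z w \<in> G) \<Longrightarrow> (\<lambda>w. F (cvec2 z w)) holomorphic_on S"
proof -
  have *: "(\<lambda>z. F (l z)) field_differentiable (at z)"
    if "l z \<in> G" "(l has_derivative (\<lambda>h. h *s v)) (at z)" for l v z
  proof -
    from bspec[OF assms[unfolded holomorphic2_on_def] that(1)]
    obtain D where D: "(F has_derivative D) (at (l z))" and D_scale: "\<forall>c w. D (c *s w) = c * D w"
      by (elim exE conjE)
    have "((\<lambda>z. F (l z)) has_derivative (\<lambda>h. D (h *s v))) (at z)"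
      using has_derivative_compose[OF that(2) D] .
    then have "((\<lambda>z. F (l z)) has_field_derivative D v) (at z)"
      by (simp add: has_field_derivative_def D_scale mult_commute_abs)
    then show ?thesis unfolding field_differentiable_def by blast
  qed
  show "(\<lambda>z. F (cvec2 z w)) holomorphic_on S" if "\<And>z. z \<in> S \<Longrightarrow> cvec2 z w \<in> G"
    unfolding holomorphic_on_def
    using *[OF that has_derivative_cvec2(1)] by (auto intro: field_differentiable_at_within)
  show "(\<lambda>w. F (cvec2 z w)) holomorphic_on S" if "\<And>w. w \<in> S \<Longrightarrow> cvec2 z w \<in> G"
    unfolding holomorphic_on_def
    using *[OF that has_derivative_cvec2(2)] by (auto intro: field_differentiable_at_within)
qed

lemma holomorphic2_on_continuous: "holomorphic2_on F G \<Longrightarrow> continuous_on G F"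
  by (rule continuous_at_imp_continuous_on)
    (auto simp: holomorphic2_on_def dest!: bspec intro: has_derivative_continuous)

text \<open>Cauchy's estimates need the bound on circles, which are null sets in two complex
  dimensions. By continuity the points violating an essential bound form an open set, and a nonempty
  open set is not negligible.\<close>

lemma AE_norm_le_imp_norm_le:
  fixes F :: "'a::euclidean_space \<Rightarrow> 'b::real_normed_vector"
  assumes G: "open G" and F: "continuous_on G F" and ae: "AE z in lebesgue_on G. norm (F z) \<le> B"
    and z: "z \<in> G"
  shows "norm (F z) \<le> B"
proof (rule ccontr)
  assume "\<not> norm (F z) \<le> B"
  define U where "U = {z \<in> G. norm (F z) \<in> {B<..}}"
  have "open U"
    unfolding U_def using continuous_open_preimage[OF continuous_on_norm[OF F] G, of "{B<..}"]
    by (simp add: vimage_def Int_def)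
  moreover have "z \<in> U" using z \<open>\<not> norm (F z) \<le> B\<close> by (simp add: U_def)
  ultimately have "\<not> negligible U" using open_not_negligible by blast
  moreover have "negligible U"
  proof -
    have "AE z in lebesgue. z \<in> G \<longrightarrow> norm (F z) \<le> B"
      using ae G by (simp add: AE_restrict_space_iff)
    then have "AE z in lebesgue. z \<notin> U" by eventually_elim (auto simp: U_def)
    then have "U \<in> null_sets lebesgue"
      using \<open>open U\<close> by (subst AE_iff_null_sets) auto
    then show ?thesis by (simp add: negligible_iff_null_sets)
  qed
  ultimately show False by simp
qed

text \<open>Cauchy's inequality bounds the coefficient of order \<open>k\<close> by
  \<open>B / r ^ k\<close>; at distance at most \<open>r / 2\<close> the remainder is dominated by a
  geometric series of ratio 1/2, whose sum is the factor 2.\<close>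

lemma Taylor_polynomial_bound:
  assumes g: "g holomorphic_on ball a R" and r: "0 < r" "r < R"
    and B: "\<And>z. norm (z - a) = r \<Longrightarrow> norm (g z) \<le> B" and z: "norm (z - a) \<le> r / 2"
  shows "norm (g z - (\<Sum>k<p. (deriv ^^ k) g a / fact k * (z - a) ^ k)) \<le> 2 * B * (1/2) ^ p"
proof (rule norm_sums_le)
  let ?t = "\<lambda>k. (deriv ^^ k) g a / fact k * (z - a) ^ k"
  have "norm (z - a) < R" using z r by linarith
  then have "?t sums g z"
    using holomorphic_power_series[OF g] by (simp add: dist_norm norm_minus_commute)
  then show "(\<lambda>k. ?t (k + p)) sums (g z - (\<Sum>k<p. ?t k))" by (rule sums_split_initial_segment)
  have "(\<lambda>k. (1/2::real) ^ k) sums 2" using geometric_sums[of "1/2::real"] by simp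
  from sums_mult[OF this, of "B * (1/2) ^ p"]
  show "(\<lambda>k. B * (1/2) ^ p * (1/2) ^ k) sums (2 * B * (1/2) ^ p)" by (simp add: mult_ac)
  fix k
  \<comment> \<open>The circle is not empty: it contains \<open>a + of_real r\<close>.\<close>
  have B0: "0 \<le> B" using B[of "a + of_real r"] r by (metis abs_of_pos add_diff_cancel_left' norm_ge_zero norm_of_real order_trans)
  have sub: "cball a r \<subseteq> ball a R" "ball a r \<subseteq> ball a R" using r by auto
  have "norm ((deriv ^^ (k + p)) g a) \<le> fact (k + p) * B / r ^ (k + p)"
    by (rule Cauchy_inequality)
      (use holomorphic_on_subset[OF g sub(2)] holomorphic_on_imp_continuous_on[OF holomorphic_on_subset[OF g sub(1)]] r B
       in \<open>auto simp: norm_minus_commute\<close>)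
  then have "norm ((deriv ^^ (k + p)) g a / fact (k + p)) \<le> B / r ^ (k + p)"
    by (simp add: norm_divide field_simps)
  moreover have "norm (z - a) ^ (k + p) \<le> (r / 2) ^ (k + p)" using z by (intro power_mono) auto
  ultimately have "norm (?t (k + p)) \<le> B / r ^ (k + p) * (r / 2) ^ (k + p)"
    unfolding norm_mult norm_power using B0 r by (intro mult_mono) auto
  also have "\<dots> = B * (1/2) ^ p * (1/2) ^ k"
    using r by (simp add: power_divide power_add field_simps)
  finally show "norm (?t (k + p)) \<le> B * (1/2) ^ p * (1/2) ^ k" .
qed

text \<open>The Taylor coefficients of \<open>z \<mapsto> F (z, w)\<close> are contour integrals of \<open>F (\<cdot>, w)\<close> over the circle; the
  second Taylor expansion, in \<open>w\<close>, is carried out under that integral. In this way no holomorphic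
  dependence of the coefficients on \<open>w\<close> is needed.\<close>

lemma polydisc_polynomial_approximation:
  assumes F: "holomorphic2_on F G" and r: "0 < r" "r < R"
    and G: "\<And>z w. z \<in> ball a R \<Longrightarrow> w \<in> ball b R \<Longrightarrow> cvec2 z w \<in> G"
    and F1: "\<And>z. z \<in> G \<Longrightarrow> norm (F z) \<le> 1"
  shows "\<exists>e. \<forall>z w. norm (z - a) \<le> r / 2 \<longrightarrow> norm (w - b) \<le> r / 2 \<longrightarrow>
    norm (F (cvec2 z w) - (\<Sum>i<p. \<Sum>j<p. e i j * (z - a) ^ i * (w - b) ^ j)) \<le> 6 * (1/2) ^ p"
proof -
  have hol1: "(\<lambda>z. F (cvec2 z w)) holomorphic_on ball a R" if "w \<in> ball b R" for w
    using holomorphic2_on_slices(1)[OF F] G that by blast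
  have hol2: "(\<lambda>w. F (cvec2 z w)) holomorphic_on ball b R" if "z \<in> ball a R" for z
    using holomorphic2_on_slices(2)[OF F] G that by blast
  have sub: "cball a r \<subseteq> ball a R" "ball a r \<subseteq> ball a R" "sphere a r \<subseteq> ball a R"
    "cball b r \<subseteq> ball b R" "ball b r \<subseteq> ball b R" using r by auto
  define c where "c i w = (deriv ^^ i) (\<lambda>z. F (cvec2 z w)) a / fact i" for i w
  define d where "d j z = (deriv ^^ j) (\<lambda>w. F (cvec2 z w)) b / fact j" for j z
  \<comment> \<open>Continuity on the circle makes the contour integrals \<open>I i j\<close> exist.
    Cauchy's inequality is applied to the difference of two nearby slices, which is uniformly small
    by compactness; \<open>r ^ j / 2\<close> in \<open>\<epsilon>'\<close> cancels its denominator
    and leaves room for strictness.\<close>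
  have cont_d: "continuous_on (sphere a r) (d j)" for j
    unfolding continuous_on_iff
  proof (intro ballI allI impI)
    fix u and \<epsilon> :: real assume u: "u \<in> sphere a r" and \<epsilon>: "\<epsilon> > 0"
    define \<epsilon>' where "\<epsilon>' = \<epsilon> * r ^ j / 2"
    have \<epsilon>': "\<epsilon>' > 0" using \<epsilon> r by (simp add: \<epsilon>'_def)
    let ?K = "sphere a r \<times> cball b r" and ?F = "\<lambda>p. F (cvec2 (fst p) (snd p))"
    have "continuous_on ?K ?F"
    proof (rule continuous_on_compose2[OF holomorphic2_on_continuous[OF F]])
      show "continuous_on ?K (\<lambda>p. cvec2 (fst p) (snd p))" by (intro continuous_intros)
    qed (use G sub in auto)
    then have "uniformly_continuous_on ?K ?F"
      by (intro compact_uniformly_continuous compact_Times) auto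
    then obtain \<delta> where \<delta>: "\<delta> > 0" "\<And>p q. p \<in> ?K \<Longrightarrow> q \<in> ?K \<Longrightarrow> dist q p < \<delta> \<Longrightarrow> dist (?F q) (?F p) < \<epsilon>'"
      using \<epsilon>' unfolding uniformly_continuous_on_def by metis
    have "dist (d j v) (d j u) < \<epsilon>" if v: "v \<in> sphere a r" "dist v u < \<delta>" for v
    proof -
      have uv: "u \<in> ball a R" "v \<in> ball a R" using u v sub by auto
      let ?h = "\<lambda>w. F (cvec2 v w) - F (cvec2 u w)"
      have h: "?h holomorphic_on ball b R" using uv by (intro holomorphic_intros hol2)
      have "norm ((deriv ^^ j) ?h b) \<le> fact j * \<epsilon>' / r ^ j"
      proof (rule Cauchy_inequality)
        show "?h holomorphic_on ball b r" using h sub holomorphic_on_subset by blast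
        show "continuous_on (cball b r) ?h"
          using holomorphic_on_imp_continuous_on[OF holomorphic_on_subset[OF h sub(4)]] .
        show "norm (?h w) \<le> \<epsilon>'" if "norm (b - w) = r" for w
          using \<delta>(2)[of "(u, w)" "(v, w)"] that u v by (simp add: dist_norm dist_Pair_Pair)
      qed (use r in auto)
      moreover have "(deriv ^^ j) ?h b = (deriv ^^ j) (\<lambda>w. F (cvec2 v w)) b - (deriv ^^ j) (\<lambda>w. F (cvec2 u w)) b"
        by (rule higher_deriv_diff[OF hol2 hol2]) (use uv r in auto)
      ultimately have "norm (d j v - d j u) \<le> \<epsilon>' / r ^ j"
        by (simp add: d_def diff_divide_distrib[symmetric] norm_divide field_simps)
      also have "\<dots> < \<epsilon>" using \<epsilon> r by (simp add: \<epsilon>'_def)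
      finally show ?thesis by (simp add: dist_norm)
    qed
    then show "\<exists>\<delta>>0. \<forall>v\<in>sphere a r. dist v u < \<delta> \<longrightarrow> dist (d j v) (d j u) < \<epsilon>"
      using \<delta>(1) by blast
  qed
  define I where "I i j = contour_integral (circlepath a r) (\<lambda>u. d j u / (u - a) ^ Suc i)" for i j
  have I: "((\<lambda>u. d j u / (u - a) ^ Suc i) has_contour_integral I i j) (circlepath a r)" for i j
    unfolding I_def
  proof (intro has_contour_integral_integral contour_integrable_continuous_circlepath)
    show "continuous_on (path_image (circlepath a r)) (\<lambda>u. d j u / (u - a) ^ Suc i)"
      using r cont_d by (auto intro!: continuous_intros)
  qed
  \<comment> \<open>This is Cauchy's formula for the mixed Taylor coefficient, used here merely as a
    definition.\<close>
  define e where "e i j = I i j / (2 * of_real pi * \<i>)" for i j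
  have coeff: "norm (c i w - (\<Sum>j<p. e i j * (w - b) ^ j)) \<le> 2 * (1/2) ^ p / r ^ i"
    if w: "norm (w - b) \<le> r / 2" for i w
  proof -
    have wR: "w \<in> ball b R" using w r by (auto simp: dist_norm norm_minus_commute)
    have "((\<lambda>u. F (cvec2 u w) / (u - a) ^ Suc i) has_contour_integral
        (2 * pi * \<i>) / fact i * (deriv ^^ i) (\<lambda>z. F (cvec2 z w)) a) (circlepath a r)"
      by (rule Cauchy_has_contour_integral_higher_derivative_circlepath)
        (use holomorphic_on_subset[OF hol1[OF wR] sub(2)]
            holomorphic_on_imp_continuous_on[OF holomorphic_on_subset[OF hol1[OF wR] sub(1)]] r in auto)
    moreover have "(2 * pi * \<i>) / fact i * (deriv ^^ i) (\<lambda>z. F (cvec2 z w)) a = 2 * pi * \<i> * c i w"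
      by (simp add: c_def)
    ultimately have 1: "((\<lambda>u. F (cvec2 u w) / (u - a) ^ Suc i) has_contour_integral 2 * pi * \<i> * c i w) (circlepath a r)"
      by simp
    have "((\<lambda>u. \<Sum>j<p. (w - b) ^ j * (d j u / (u - a) ^ Suc i)) has_contour_integral
        (\<Sum>j<p. (w - b) ^ j * I i j)) (circlepath a r)"
      by (intro has_contour_integral_sum has_contour_integral_lmul I) auto
    from has_contour_integral_diff[OF 1 this]
    have "((\<lambda>u. (F (cvec2 u w) - (\<Sum>j<p. d j u * (w - b) ^ j)) / (u - a) ^ Suc i) has_contour_integral
        2 * pi * \<i> * c i w - (\<Sum>j<p. (w - b) ^ j * I i j)) (circlepath a r)"
      by (simp add: diff_divide_distrib sum_divide_distrib mult_ac)
    then have "norm (2 * pi * \<i> * c i w - (\<Sum>j<p. (w - b) ^ j * I i j))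
        \<le> (2 * (1/2) ^ p / r ^ Suc i) * (2 * pi * r)"
    proof (rule has_contour_integral_bound_circlepath)
      fix u assume u: "norm (u - a) = r"
      then have uR: "u \<in> ball a R" using r by (auto simp: dist_norm norm_minus_commute)
      have "norm (F (cvec2 u w) - (\<Sum>j<p. d j u * (w - b) ^ j)) \<le> 2 * 1 * (1/2) ^ p"
        unfolding d_def
        by (rule Taylor_polynomial_bound[OF hol2[OF uR] r])
          (use w r in \<open>auto intro!: F1 G uR simp: dist_norm norm_minus_commute\<close>)
      then show "norm ((F (cvec2 u w) - (\<Sum>j<p. d j u * (w - b) ^ j)) / (u - a) ^ Suc i) \<le> 2 * (1/2) ^ p / r ^ Suc i"
        unfolding norm_divide norm_power u using r by (intro divide_right_mono) auto
    qed (use r in auto)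
    moreover have "2 * pi * \<i> * c i w - (\<Sum>j<p. (w - b) ^ j * I i j)
        = 2 * pi * \<i> * (c i w - (\<Sum>j<p. e i j * (w - b) ^ j))"
      by (simp add: right_diff_distrib sum_distrib_left e_def mult_ac)
    moreover have "norm (2 * pi * \<i> * X) = 2 * pi * norm X" for X by (simp add: norm_mult)
    moreover have "(2 * (1/2) ^ p / r ^ Suc i) * (2 * pi * r) = 2 * pi * (2 * (1/2) ^ p / r ^ i)"
      using r by simp
    ultimately have "2 * pi * norm (c i w - (\<Sum>j<p. e i j * (w - b) ^ j)) \<le> 2 * pi * (2 * (1/2) ^ p / r ^ i)"
      by metis
    then show ?thesis by (rule mult_left_le_imp_le) simp
  qed
  \<comment> \<open>The constant is 6 = 2 + 4: the Taylor remainder in \<open>z\<close> contributes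
    2, and the coefficient errors, weighted with \<open>(1/2) ^ i\<close> and summed over
    \<open>i\<close>, at most 2 * 2.\<close>
  have approx: "norm (F (cvec2 z w) - (\<Sum>i<p. \<Sum>j<p. e i j * (z - a) ^ i * (w - b) ^ j)) \<le> 6 * (1/2) ^ p"
    if z: "norm (z - a) \<le> r / 2" and w: "norm (w - b) \<le> r / 2" for z w
  proof -
    have wR: "w \<in> ball b R" using w r by (auto simp: dist_norm norm_minus_commute)
    have 1: "norm (F (cvec2 z w) - (\<Sum>i<p. c i w * (z - a) ^ i)) \<le> 2 * 1 * (1/2) ^ p"
      unfolding c_def
      by (rule Taylor_polynomial_bound[OF hol1[OF wR] r])
        (use z r in \<open>auto intro!: F1 G wR simp: dist_norm norm_minus_commute\<close>)
    have "norm (\<Sum>i<p. (c i w - (\<Sum>j<p. e i j * (w - b) ^ j)) * (z - a) ^ i) \<le> (\<Sum>i<p. 2 * (1/2) ^ p * (1/2) ^ i)"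
    proof (rule sum_norm_le)
      fix i
      have "norm ((c i w - (\<Sum>j<p. e i j * (w - b) ^ j)) * (z - a) ^ i) \<le> (2 * (1/2) ^ p / r ^ i) * (r / 2) ^ i"
        unfolding norm_mult norm_power using z r coeff[OF w] by (intro mult_mono power_mono) auto
      also have "\<dots> = 2 * (1/2) ^ p * (1/2) ^ i" using r by (simp add: power_divide field_simps)
      finally show "norm ((c i w - (\<Sum>j<p. e i j * (w - b) ^ j)) * (z - a) ^ i) \<le> 2 * (1/2) ^ p * (1/2) ^ i" .
    qed
    also have "\<dots> = 2 * (1/2) ^ p * (\<Sum>i<p. (1/2) ^ i)" by (simp add: sum_distrib_left)
    also have "\<dots> \<le> 2 * (1/2) ^ p * 2"
    proof (rule mult_left_mono)
      have "(\<Sum>i<p. (1/2::real) ^ i) \<le> (\<Sum>i. (1/2) ^ i)" by (rule sum_le_suminf) (auto intro: summable_geometric)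
      then show "(\<Sum>i<p. (1/2::real) ^ i) \<le> 2" by (simp add: suminf_geometric)
    qed simp
    finally have 2: "norm (\<Sum>i<p. (c i w - (\<Sum>j<p. e i j * (w - b) ^ j)) * (z - a) ^ i) \<le> 4 * (1/2) ^ p"
      by simp
    have "F (cvec2 z w) - (\<Sum>i<p. \<Sum>j<p. e i j * (z - a) ^ i * (w - b) ^ j)
        = (F (cvec2 z w) - (\<Sum>i<p. c i w * (z - a) ^ i)) + (\<Sum>i<p. (c i w - (\<Sum>j<p. e i j * (w - b) ^ j)) * (z - a) ^ i)"
      unfolding left_diff_distrib sum_subtractf sum_distrib_right
      by (simp add: mult.assoc mult.commute[of "(w - b) ^ _"])
    then have "norm (F (cvec2 z w) - (\<Sum>i<p. \<Sum>j<p. e i j * (z - a) ^ i * (w - b) ^ j))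
        \<le> norm (F (cvec2 z w) - (\<Sum>i<p. c i w * (z - a) ^ i))
          + norm (\<Sum>i<p. (c i w - (\<Sum>j<p. e i j * (w - b) ^ j)) * (z - a) ^ i)"
      using norm_triangle_ineq[of "F (cvec2 z w) - (\<Sum>i<p. c i w * (z - a) ^ i)"
          "\<Sum>i<p. (c i w - (\<Sum>j<p. e i j * (w - b) ^ j)) * (z - a) ^ i"] by metis
    then show ?thesis using 1 2 by linarith
  qed
  show ?thesis by (intro exI[of _ e] allI impI) (rule approx)
qed

text \<open>The radius depends on \<open>y\<close> and \<open>G\<close> but neither on the datum nor
  on the degree, because every datum obeys the same bound on \<open>G\<close>. This uniformity
  allows one finite cover for all of them.\<close>

lemma analytic_data_local_approximation:
  assumes "open G" "of_real2 y \<in> G"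
  shows "\<exists>\<rho>>0. \<forall>f\<in>analytic_data \<Omega> G. \<forall>p. \<exists>e. \<forall>x\<in>\<Omega>. \<bar>x $ 1 - y $ 1\<bar> < \<rho> \<longrightarrow> \<bar>x $ 2 - y $ 2\<bar> < \<rho> \<longrightarrow>
    \<bar>f x - (\<Sum>i<p. \<Sum>j<p. e i j * ((x $ 1 - y $ 1) ^ i * (x $ 2 - y $ 2) ^ j))\<bar> \<le> 6 * (1/2) ^ p"
proof -
  obtain \<epsilon> where \<epsilon>: "\<epsilon> > 0" "ball (of_real2 y) \<epsilon> \<subseteq> G" using assms by (rule openE)
  let ?a = "complex_of_real (y $ 1)" and ?b = "complex_of_real (y $ 2)"
  have G: "cvec2 z w \<in> G" if "z \<in> ball ?a (\<epsilon> / 2)" "w \<in> ball ?b (\<epsilon> / 2)" for z w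
  proof -
    have "norm (cvec2 z w - of_real2 y) < \<epsilon>"
      using norm_cvec2_diff[of z w ?a ?b] that unfolding of_real2_eq_cvec2[of y]
      by (simp add: dist_norm norm_minus_commute)
    then show ?thesis using \<epsilon>(2) by (auto simp: dist_norm norm_minus_commute)
  qed
  show ?thesis
  \<comment> \<open>Radii: \<open>\<epsilon> / 2\<close> in each coordinate stays in the ball of
    radius \<open>\<epsilon>\<close>, Cauchy's estimates are used on \<open>\<epsilon> / 4\<close>,
    and the expansion is valid on half of that.\<close>
  proof (intro exI[of _ "\<epsilon> / 8"] conjI ballI allI)
    fix f p assume "f \<in> analytic_data \<Omega> G"
    then obtain F where F: "holomorphic2_on F G" "\<And>x. x \<in> \<Omega> \<Longrightarrow> F (of_real2 x) = complex_of_real (f x)"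
      "AE z in lebesgue_on G. norm (F z) \<le> 1"
      by (auto simp: analytic_data_def)
    have F1: "norm (F z) \<le> 1" if "z \<in> G" for z
      using AE_norm_le_imp_norm_le[OF assms(1) holomorphic2_on_continuous[OF F(1)] F(3) that] .
    have "0 < \<epsilon> / 4" "\<epsilon> / 4 < \<epsilon> / 2" using \<epsilon> by auto
    from polydisc_polynomial_approximation[OF F(1) this G F1]
    obtain e where e: "\<forall>z w. norm (z - ?a) \<le> \<epsilon> / 4 / 2 \<longrightarrow> norm (w - ?b) \<le> \<epsilon> / 4 / 2 \<longrightarrow>
      norm (F (cvec2 z w) - (\<Sum>i<p. \<Sum>j<p. e i j * (z - ?a) ^ i * (w - ?b) ^ j)) \<le> 6 * (1/2) ^ p"
      by blast
    show "\<exists>e. \<forall>x\<in>\<Omega>. \<bar>x $ 1 - y $ 1\<bar> < \<epsilon> / 8 \<longrightarrow> \<bar>x $ 2 - y $ 2\<bar> < \<epsilon> / 8 \<longrightarrow>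
      \<bar>f x - (\<Sum>i<p. \<Sum>j<p. e i j * ((x $ 1 - y $ 1) ^ i * (x $ 2 - y $ 2) ^ j))\<bar> \<le> 6 * (1/2) ^ p"
    \<comment> \<open>At real points the monomials and the datum are real, so taking real parts of
      the coefficients does not increase the error.\<close>
    proof (intro exI[of _ "\<lambda>i j. Re (e i j)"] ballI impI)
      fix x assume x: "x \<in> \<Omega>" "\<bar>x $ 1 - y $ 1\<bar> < \<epsilon> / 8" "\<bar>x $ 2 - y $ 2\<bar> < \<epsilon> / 8"
      let ?z = "complex_of_real (x $ 1)" and ?w = "complex_of_real (x $ 2)"
      have n: "norm (?z - ?a) \<le> \<epsilon> / 4 / 2" "norm (?w - ?b) \<le> \<epsilon> / 4 / 2"
        using x unfolding of_real_diff[symmetric] norm_of_real by auto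
      have "Re (e i j * (?z - ?a) ^ i * (?w - ?b) ^ j) = Re (e i j) * ((x $ 1 - y $ 1) ^ i * (x $ 2 - y $ 2) ^ j)" for i j
        unfolding of_real_diff[symmetric] of_real_power[symmetric] mult.assoc of_real_mult[symmetric]
        by simp
      then have "f x - (\<Sum>i<p. \<Sum>j<p. Re (e i j) * ((x $ 1 - y $ 1) ^ i * (x $ 2 - y $ 2) ^ j))
          = Re (F (cvec2 ?z ?w) - (\<Sum>i<p. \<Sum>j<p. e i j * (?z - ?a) ^ i * (?w - ?b) ^ j))"
        using F(2)[OF x(1)] by (simp add: of_real2_eq_cvec2 del: times_complex.sel)
      also have "\<bar>\<dots>\<bar> \<le> 6 * (1/2) ^ p"
        using e[rule_format, OF n] by (rule order_trans[OF abs_Re_le_cmod])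
      finally show "\<bar>f x - (\<Sum>i<p. \<Sum>j<p. Re (e i j) * ((x $ 1 - y $ 1) ^ i * (x $ 2 - y $ 2) ^ j))\<bar> \<le> 6 * (1/2) ^ p" .
    qed
  qed (use \<epsilon> in auto)
qed

section \<open>Gluing local polynomials on finitely many boxes\<close>

lemma L2_indicator_mult:
  assumes "f \<in> L2 \<Omega>" "B \<in> sets borel"
  shows "(\<lambda>x. indicator B x * f x) \<in> L2 \<Omega>"
proof -
  have B: "(indicator B :: real^2 \<Rightarrow> real) \<in> borel_measurable (lebesgue_on \<Omega>)"
    using assms(2) by (intro measurable_restrict_space1 measurable_completion) (auto intro: borel_measurable_indicator)
  then have m: "(\<lambda>x. indicator B x * f x) \<in> borel_measurable (lebesgue_on \<Omega>)"
    using L2_measurable[OF assms(1)] by (intro borel_measurable_times)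
  have "integrable (lebesgue_on \<Omega>) (\<lambda>x. (indicator B x * f x)\<^sup>2)"
  proof (rule Bochner_Integration.integrable_bound)
    show "integrable (lebesgue_on \<Omega>) (\<lambda>x. (f x)\<^sup>2)" using assms(1) by (simp add: L2_def)
    show "(\<lambda>x. (indicator B x * f x)\<^sup>2) \<in> borel_measurable (lebesgue_on \<Omega>)"
      using m by (rule borel_measurable_power)
  qed (auto simp: indicator_def)
  then show ?thesis using m by (simp add: L2_def)
qed

text \<open>The order of quantifiers is what the width requires: \<open>M\<close> precedes the
  degree, and the functions \<open>q\<close> precede the datum, which only selects the coefficients.
  A finite cover exists because the compact closure of \<open>\<Omega>\<close>, and not just
  \<open>\<Omega>\<close>, is mapped into \<open>G\<close>.\<close>

lemma analytic_data_approximation: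
  assumes \<Omega>: "open \<Omega>" "bounded \<Omega>" "\<Omega> \<noteq> {}" and G: "open G" "of_real2 ` closure \<Omega> \<subseteq> G"
  shows "\<exists>M>0. \<forall>p. \<exists>q. (\<forall>k. q k \<in> L2 \<Omega>) \<and> (\<forall>f\<in>analytic_data \<Omega> G. \<exists>c.
    L2_norm \<Omega> (\<lambda>x. f x - (\<Sum>k<M * p\<^sup>2. c k * q k x)) \<le> 6 * (1/2) ^ p * sqrt (measure lebesgue \<Omega>))"
proof -
  have Om: "\<Omega> \<in> lmeasurable" using \<Omega> by (intro lmeasurable_open)
  define P where "P (y::real^2) \<rho> \<longleftrightarrow> \<rho> > 0 \<and> (\<forall>f\<in>analytic_data \<Omega> G. \<forall>p. \<exists>e. \<forall>x\<in>\<Omega>. \<bar>x $ 1 - y $ 1\<bar> < \<rho> \<longrightarrow> \<bar>x $ 2 - y $ 2\<bar> < \<rho> \<longrightarrow>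
    \<bar>f x - (\<Sum>i<p. \<Sum>j<p. e i j * ((x $ 1 - y $ 1) ^ i * (x $ 2 - y $ 2) ^ j))\<bar> \<le> 6 * (1/2) ^ p)" for y \<rho>
  have "\<exists>\<rho>. P y \<rho>" if "y \<in> closure \<Omega>" for y
    unfolding P_def using analytic_data_local_approximation[OF G(1), of y \<Omega>] G(2) that by auto
  then obtain \<rho> where \<rho>: "\<And>y. y \<in> closure \<Omega> \<Longrightarrow> P y (\<rho> y)" by metis
  define U where "U y = {x :: real^2. \<bar>x $ 1 - y $ 1\<bar> < \<rho> y} \<inter> {x. \<bar>x $ 2 - y $ 2\<bar> < \<rho> y}" for y
  have openU: "open (U y)" for y
    unfolding U_def by (intro open_Int open_Collect_less continuous_intros)
  have "compact (closure \<Omega>)" using \<Omega> by simp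
  moreover have "closure \<Omega> \<subseteq> (\<Union>y\<in>closure \<Omega>. U y)"
  proof
    fix y assume y: "y \<in> closure \<Omega>"
    then have "y \<in> U y" using \<rho>[OF y] by (simp add: U_def P_def)
    then show "y \<in> (\<Union>y\<in>closure \<Omega>. U y)" using y by blast
  qed
  ultimately obtain T where T: "T \<subseteq> closure \<Omega>" "finite T" "closure \<Omega> \<subseteq> (\<Union>y\<in>T. U y)"
    using openU by (metis compactE_image)
  define M where "M = card T"
  obtain Y where Y: "bij_betw Y {0..<M} T" unfolding M_def using ex_bij_betw_nat_finite[OF T(2)] by blast
  have YT: "Y m \<in> closure \<Omega>" if "m < M" for m using Y that T(1) by (auto simp: bij_betw_def)
  have cov: "\<exists>m<M. x \<in> U (Y m)" if "x \<in> \<Omega>" for x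
  proof -
    have "x \<in> (\<Union>y\<in>T. U y)" using that T(3) closure_subset by blast
    then show ?thesis using Y by (force simp: bij_betw_def)
  qed
  have "M > 0" using \<Omega>(3) cov by (metis ex_in_conv gr_zeroI not_less0)
  \<comment> \<open>Removing the earlier boxes leaves exactly one active index below
    \<open>M\<close> at each point of \<open>\<Omega>\<close>, so the local polynomials can be added
    without interfering.\<close>
  define B where "B m = U (Y m) - (\<Union>l<m. U (Y l))" for m
  have B: "B m \<in> sets borel" for m unfolding B_def by (intro sets.Diff borel_open open_UN ballI openU)
  have disj: "l = m" if "x \<in> B l" "x \<in> B m" for x l m
    using that unfolding B_def by (metis Diff_iff UN_I lessThan_iff linorder_neqE_nat)
  have cov': "\<exists>m<M. x \<in> B m" if "x \<in> \<Omega>" for x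
  proof -
    define m where "m = (LEAST m. x \<in> U (Y m))"
    obtain m' where m': "m' < M" "x \<in> U (Y m')" using cov[OF \<open>x \<in> \<Omega>\<close>] by blast
    have "x \<in> U (Y m)" unfolding m_def by (rule LeastI) (rule m'(2))
    moreover have "m \<le> m'" unfolding m_def by (rule Least_le) (rule m'(2))
    moreover have "x \<notin> U (Y l)" if "l < m" for l using that not_less_Least unfolding m_def by blast
    ultimately show ?thesis using m'(1) by (intro exI[of _ m]) (auto simp: B_def)
  qed
  define g where "g = (\<lambda>(m, i, j) x. indicator (B m) x * ((x $ 1 - Y m $ 1) ^ i * (x $ 2 - Y m $ 2) ^ j) :: real)"
  have gL2: "g t \<in> L2 \<Omega>" for t
  proof -
    obtain m i j where t: "t = (m, i, j)" by (cases t)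
    have "continuous_on UNIV (\<lambda>x::real^2. (x $ 1 - Y m $ 1) ^ i * (x $ 2 - Y m $ 2) ^ j)"
      by (intro continuous_intros)
    then show ?thesis
      unfolding t g_def using L2_indicator_mult[OF L2_continuous[OF Om \<Omega>(2)] B] by simp
  qed
  show ?thesis
  proof (intro exI[of _ M] conjI allI)
    show "M > 0" by fact
    fix p :: nat
    let ?J = "{..<M} \<times> {..<p} \<times> {..<p}"
    have cJ: "card ?J = M * p\<^sup>2" by (simp add: card_cartesian_product power2_eq_square)
    \<comment> \<open>Numbers the triples of a box and two exponents; the count
      \<open>M * p\<^sup>2\<close> comes from here.\<close>
    obtain h where h: "bij_betw h {..<M * p\<^sup>2} ?J"
      using ex_bij_betw_nat_finite[of ?J] unfolding cJ by (auto simp: atLeast0LessThan)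
    show "\<exists>q. (\<forall>k. q k \<in> L2 \<Omega>) \<and> (\<forall>f\<in>analytic_data \<Omega> G. \<exists>c.
      L2_norm \<Omega> (\<lambda>x. f x - (\<Sum>k<M * p\<^sup>2. c k * q k x)) \<le> 6 * (1/2) ^ p * sqrt (measure lebesgue \<Omega>))"
    proof (intro exI[of _ "\<lambda>k. g (h k)"] conjI allI ballI)
      fix f assume f: "f \<in> analytic_data \<Omega> G"
      define Q where "Q m e \<longleftrightarrow> (\<forall>x\<in>\<Omega>. \<bar>x $ 1 - Y m $ 1\<bar> < \<rho> (Y m) \<longrightarrow> \<bar>x $ 2 - Y m $ 2\<bar> < \<rho> (Y m) \<longrightarrow>
        \<bar>f x - (\<Sum>i<p. \<Sum>j<p. e i j * ((x $ 1 - Y m $ 1) ^ i * (x $ 2 - Y m $ 2) ^ j))\<bar> \<le> 6 * (1/2) ^ p)" for m e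
      have "\<exists>e. Q m e" if "m < M" for m
        using \<rho>[OF YT[OF that]] f unfolding P_def Q_def by blast
      then have "\<forall>m. \<exists>e. m < M \<longrightarrow> Q m e" by blast
      from choice[OF this] obtain e where Qe: "\<forall>m. m < M \<longrightarrow> Q m (e m)" by (elim exE)
      have e: "\<bar>f x - (\<Sum>i<p. \<Sum>j<p. e m i j * ((x $ 1 - Y m $ 1) ^ i * (x $ 2 - Y m $ 2) ^ j))\<bar> \<le> 6 * (1/2) ^ p"
        if "m < M" "x \<in> \<Omega>" "x \<in> U (Y m)" for m x
        using Qe that by (simp add: Q_def U_def)
      define c where "c k = (case h k of (m, i, j) \<Rightarrow> e m i j)" for k
      have pt: "\<bar>f x - (\<Sum>k<M * p\<^sup>2. c k * g (h k) x)\<bar> \<le> 6 * (1/2) ^ p" if x: "x \<in> \<Omega>" for x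
      proof -
        from cov'[OF x] obtain m where m: "m < M" "x \<in> B m" by (elim exE conjE)
        have ind: "indicator (B l) x = (if l = m then 1 else 0 :: real)" for l
        proof (cases "l = m")
          case True
          then show ?thesis using m(2) by simp
        next
          case False
          then have "x \<notin> B l" using disj[OF _ m(2)] by metis
          then show ?thesis using False by simp
        qed
        have "(\<Sum>k<M * p\<^sup>2. c k * g (h k) x) = (\<Sum>t\<in>?J. (case t of (l, i, j) \<Rightarrow> e l i j) * g t x)"
          unfolding c_def by (rule sum.reindex_bij_betw[OF h])
        also have "\<dots> = (\<Sum>l<M. \<Sum>i<p. \<Sum>j<p. e l i j * g (l, i, j) x)"
          unfolding sum.cartesian_product by (rule sum.cong) auto
        also have "\<dots> = (\<Sum>l<M. if l = m then \<Sum>i<p. \<Sum>j<p. e l i j * ((x $ 1 - Y l $ 1) ^ i * (x $ 2 - Y l $ 2) ^ j) else 0)"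
          by (rule sum.cong) (auto simp: g_def ind)
        also have "\<dots> = (\<Sum>i<p. \<Sum>j<p. e m i j * ((x $ 1 - Y m $ 1) ^ i * (x $ 2 - Y m $ 2) ^ j))"
          using m(1) by simp
        finally show ?thesis using e[OF m(1) x] m(2) by (simp add: B_def)
      qed
      have "f \<in> L2 \<Omega>" using f by (simp add: analytic_data_def)
      then have "(\<lambda>x. f x - (\<Sum>k<M * p\<^sup>2. c k * g (h k) x)) \<in> L2 \<Omega>"
        by (intro L2_diff L2_sum L2_cmult gL2)
      from L2_bounded(2)[OF Om L2_measurable[OF this] pt]
      show "\<exists>c. L2_norm \<Omega> (\<lambda>x. f x - (\<Sum>k<M * p\<^sup>2. c k * g (h k) x)) \<le> 6 * (1/2) ^ p * sqrt (measure lebesgue \<Omega>)"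
        by blast
    qed (rule gL2)
  qed
qed

section \<open>The inverse fractional power and widths\<close>

text \<open>Separates the spectral argument from the differential operator, which enters only
  through a complete orthonormal system and the positive lower bound \<open>c\<close> for the
  numbers \<open>lam k\<close>.\<close>

locale spectral_basis =
  fixes \<Omega> :: "(real^2) set" and lam :: "nat \<Rightarrow> real" and \<phi> :: "nat \<Rightarrow> real^2 \<Rightarrow> real" and c :: real
  assumes lmeasurable: "\<Omega> \<in> lmeasurable"
    and \<phi>: "\<And>k. \<phi> k \<in> L2 \<Omega>"
    and orth: "\<And>j k. L2_inner \<Omega> (\<phi> j) (\<phi> k) = (if j = k then 1 else 0)"
    and complete: "\<And>f. f \<in> L2 \<Omega> \<Longrightarrow>
      (\<lambda>n. L2_norm \<Omega> (\<lambda>x. f x - (\<Sum>k<n. L2_inner \<Omega> f (\<phi> k) * \<phi> k x))) \<longlonglongrightarrow> 0"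
    and c: "0 < c" "\<And>k. c \<le> lam k"
begin

section \<open>Coefficients, fractional spaces and the inverse power\<close>

lemma lam_pos: "0 < lam k"
  using c(1) c(2)[of k] by linarith

lemma lam_powr_mult_minus: "lam k powr s * lam k powr (- s) = 1"
  using lam_pos[of k] by (simp add: powr_add[symmetric])

text \<open>The expansion of \<open>f\<close> converges in norm, and pairing with \<open>g\<close>
  is continuous by Cauchy-Schwarz.\<close>

lemma Parseval:
  assumes f: "f \<in> L2 \<Omega>" and g: "g \<in> L2 \<Omega>"
  shows "(\<lambda>k. L2_inner \<Omega> f (\<phi> k) * L2_inner \<Omega> (\<phi> k) g) sums L2_inner \<Omega> f g"
  unfolding sums_def
proof (rule LIM_zero_cancel)
  let ?S = "\<lambda>n x. \<Sum>k<n. L2_inner \<Omega> f (\<phi> k) * \<phi> k x"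
  show "(\<lambda>n. (\<Sum>k<n. L2_inner \<Omega> f (\<phi> k) * L2_inner \<Omega> (\<phi> k) g) - L2_inner \<Omega> f g) \<longlonglongrightarrow> 0"
  proof (rule Lim_null_comparison[where g="\<lambda>n. L2_norm \<Omega> (\<lambda>x. f x - ?S n x) * L2_norm \<Omega> g"])
    show "(\<lambda>n. L2_norm \<Omega> (\<lambda>x. f x - ?S n x) * L2_norm \<Omega> g) \<longlonglongrightarrow> 0"
      using tendsto_mult_left_zero[OF complete[OF f]] .
    have "norm ((\<Sum>k<n. L2_inner \<Omega> f (\<phi> k) * L2_inner \<Omega> (\<phi> k) g) - L2_inner \<Omega> f g)
        \<le> L2_norm \<Omega> (\<lambda>x. f x - ?S n x) * L2_norm \<Omega> g" for n
    proof -
      have S: "?S n \<in> L2 \<Omega>" using \<phi> by (intro L2_sum L2_cmult)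
      have "L2_inner \<Omega> (\<lambda>x. f x - ?S n x) g = L2_inner \<Omega> f g - (\<Sum>k<n. L2_inner \<Omega> f (\<phi> k) * L2_inner \<Omega> (\<phi> k) g)"
        unfolding L2_inner_diff_left[OF f S g] by (simp add: L2_inner_sum_left[OF g \<phi>])
      then show ?thesis
        using L2_Cauchy_Schwarz[OF L2_diff[OF f S] g] by (simp add: abs_minus_commute)
    qed
    then show "\<forall>\<^sub>F n in sequentially. norm ((\<Sum>k<n. L2_inner \<Omega> f (\<phi> k) * L2_inner \<Omega> (\<phi> k) g) - L2_inner \<Omega> f g)
        \<le> L2_norm \<Omega> (\<lambda>x. f x - ?S n x) * L2_norm \<Omega> g" by simp
  qed
qed

lemma sums_coeff_square:
  assumes "f \<in> L2 \<Omega>"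
  shows "(\<lambda>k. (L2_inner \<Omega> f (\<phi> k))\<^sup>2) sums L2_inner \<Omega> f f"
  using Parseval[OF assms assms] by (simp add: power2_eq_square L2_inner_commute[of \<Omega> "\<phi> _" f])

text \<open>Null functions are recognised by their coefficients, so equality almost everywhere never
  has to be argued pointwise.\<close>

lemma L2_inner_0_iff:
  assumes "f \<in> L2 \<Omega>"
  shows "L2_inner \<Omega> f f = 0 \<longleftrightarrow> (\<forall>k. L2_inner \<Omega> f (\<phi> k) = 0)"
proof
  assume "L2_inner \<Omega> f f = 0"
  then show "\<forall>k. L2_inner \<Omega> f (\<phi> k) = 0"
    using L2_Cauchy_Schwarz[OF assms \<phi>] by (simp add: L2_norm_def[of \<Omega> f])
next
  assume "\<forall>k. L2_inner \<Omega> f (\<phi> k) = 0"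
  then have "(\<lambda>k. 0) sums L2_inner \<Omega> f f" using sums_coeff_square[OF assms] by simp
  then show "L2_inner \<Omega> f f = 0" using sums_0 sums_unique2 by blast
qed

lemma frac_space_iff:
  "v \<in> frac_space \<Omega> lam \<phi> s \<longleftrightarrow> v \<in> L2 \<Omega> \<and> summable (\<lambda>k. lam k powr s * (L2_inner \<Omega> v (\<phi> k))\<^sup>2)"
  by (simp add: frac_space_def)

lemma frac_space_add:
  assumes "v \<in> frac_space \<Omega> lam \<phi> s" "w \<in> frac_space \<Omega> lam \<phi> s"
  shows "(\<lambda>x. v x + w x) \<in> frac_space \<Omega> lam \<phi> s"
  unfolding frac_space_iff
proof
  have vw: "v \<in> L2 \<Omega>" "w \<in> L2 \<Omega>" using assms by (auto simp: frac_space_iff)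
  then show "(\<lambda>x. v x + w x) \<in> L2 \<Omega>" by (rule L2_add)
  have "summable (\<lambda>k. 2 * (lam k powr s * (L2_inner \<Omega> v (\<phi> k))\<^sup>2) + 2 * (lam k powr s * (L2_inner \<Omega> w (\<phi> k))\<^sup>2))"
    using assms by (intro summable_add summable_mult) (auto simp: frac_space_iff)
  then show "summable (\<lambda>k. lam k powr s * (L2_inner \<Omega> (\<lambda>x. v x + w x) (\<phi> k))\<^sup>2)"
  proof (rule summable_comparison_test')
    fix k :: nat
    have "(a + b)\<^sup>2 \<le> 2 * a\<^sup>2 + 2 * b\<^sup>2" for a b :: real
      using zero_le_power2[of "a - b"] by (simp add: power2_sum power2_diff)
    from mult_left_mono[OF this, of "lam k powr s" "L2_inner \<Omega> v (\<phi> k)" "L2_inner \<Omega> w (\<phi> k)"]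
    show "norm (lam k powr s * (L2_inner \<Omega> (\<lambda>x. v x + w x) (\<phi> k))\<^sup>2)
      \<le> 2 * (lam k powr s * (L2_inner \<Omega> v (\<phi> k))\<^sup>2) + 2 * (lam k powr s * (L2_inner \<Omega> w (\<phi> k))\<^sup>2)"
      by (simp add: L2_inner_add_left vw \<phi> algebra_simps)
  qed
qed

lemma frac_space_cmult:
  assumes "v \<in> frac_space \<Omega> lam \<phi> s"
  shows "(\<lambda>x. a * v x) \<in> frac_space \<Omega> lam \<phi> s"
  using assms
  by (simp add: frac_space_iff L2_cmult L2_inner_cmult_left power_mult_distrib mult.left_commute[of _ "a\<^sup>2"] summable_mult)

lemma frac_space_sum:
  "(\<And>i. i \<in> I \<Longrightarrow> v i \<in> frac_space \<Omega> lam \<phi> s) \<Longrightarrow> (\<lambda>x. \<Sum>i\<in>I. v i x) \<in> frac_space \<Omega> lam \<phi> s"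
proof (induction I rule: infinite_finite_induct)
  case (insert i I)
  then show ?case using frac_space_add[of "v i" s "\<lambda>x. \<Sum>i\<in>I. v i x"] by simp
qed (simp_all add: frac_space_iff L2_inner_def)

text \<open>Only one coefficient is nonzero. Eigenfunctions thus serve as test functions that read
  off coefficients, and later to complete families that are too short.\<close>

lemma eigenfunction_in_frac_space: "\<phi> j \<in> frac_space \<Omega> lam \<phi> s"
  unfolding frac_space_iff by (auto simp: \<phi> orth intro!: summable_finite[of "{j}"] split: if_splits)

lemma powr_minus_lam_le: "0 \<le> t \<Longrightarrow> lam k powr (- t) \<le> c powr (- t)"
  using c by (simp add: powr_mono2')

text \<open>A solution is constructed from the expected coefficients by
  \<open>Riesz_Fischer\<close>, so the choice in \<open>frac_inv\<close> is not empty. Testing with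
  \<open>\<phi> k\<close> then determines the coefficients of whichever solution was chosen.\<close>

lemma frac_inv_coeff:
  assumes f: "f \<in> L2 \<Omega>" and s: "0 < s"
  shows "frac_inv \<Omega> lam \<phi> s f \<in> frac_space \<Omega> lam \<phi> s"
    and "L2_inner \<Omega> (frac_inv \<Omega> lam \<phi> s f) (\<phi> k) = lam k powr (- s) * L2_inner \<Omega> f (\<phi> k)"
proof -
  let ?P = "\<lambda>v. v \<in> frac_space \<Omega> lam \<phi> s \<and> (\<forall>w\<in>frac_space \<Omega> lam \<phi> s. frac_op \<Omega> lam \<phi> s v w = L2_inner \<Omega> f w)"
  let ?f = "\<lambda>k. L2_inner \<Omega> f (\<phi> k)"
  define a where "a k = lam k powr (- s) * ?f k" for k
  have sf: "summable (\<lambda>k. (?f k)\<^sup>2)" using sums_coeff_square[OF f] by (rule sums_summable)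
  have "summable (\<lambda>k. (a k)\<^sup>2)"
  proof (rule summable_comparison_test'[OF summable_mult[OF sf, of "(c powr (- s))\<^sup>2"]])
    fix k :: nat
    have "(lam k powr (- s))\<^sup>2 \<le> (c powr (- s))\<^sup>2"
      using powr_minus_lam_le[of s k] s by (intro power_mono) auto
    then show "norm ((a k)\<^sup>2) \<le> (c powr (- s))\<^sup>2 * (?f k)\<^sup>2"
      by (simp add: a_def power_mult_distrib mult_right_mono)
  qed
  then obtain v where v: "v \<in> L2 \<Omega>" "\<And>k. L2_inner \<Omega> v (\<phi> k) = a k"
    using Riesz_Fischer[OF lmeasurable \<phi> orth, of a] by auto
  have lam_a: "lam k powr s * a k = ?f k" for k
    unfolding a_def mult.assoc[symmetric] lam_powr_mult_minus by simp
  have "v \<in> frac_space \<Omega> lam \<phi> s"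
    unfolding frac_space_iff v(2)
  proof (rule conjI[OF v(1)], rule summable_comparison_test'[OF summable_mult[OF sf, of "c powr (- s)"]])
    fix k :: nat
    have "lam k powr s * (a k)\<^sup>2 = (lam k powr s * a k) * a k" by (simp add: power2_eq_square)
    then have "lam k powr s * (a k)\<^sup>2 = lam k powr (- s) * (?f k)\<^sup>2"
      unfolding lam_a by (simp add: a_def power2_eq_square)
    then show "norm (lam k powr s * (a k)\<^sup>2) \<le> c powr (- s) * (?f k)\<^sup>2"
      using powr_minus_lam_le[of s k] s by (simp add: mult_right_mono)
  qed
  moreover have "frac_op \<Omega> lam \<phi> s v w = L2_inner \<Omega> f w" if "w \<in> frac_space \<Omega> lam \<phi> s" for w
    using Parseval[OF f, of w] that unfolding frac_op_def v(2) lam_a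
    by (simp add: frac_space_iff sums_iff)
  ultimately have "\<exists>v. ?P v" by blast
  then have P: "?P (frac_inv \<Omega> lam \<phi> s f)"
    unfolding frac_inv_def by (rule someI_ex)
  then show "frac_inv \<Omega> lam \<phi> s f \<in> frac_space \<Omega> lam \<phi> s" by (rule conjunct1)
  let ?v = "frac_inv \<Omega> lam \<phi> s f"
  \<comment> \<open>From here on nothing is known about \<open>?v\<close> except that it solves the
    equation; orthonormality reduces the series to a single term.\<close>
  have "?f k = frac_op \<Omega> lam \<phi> s ?v (\<phi> k)"
    using P eigenfunction_in_frac_space by simp
  also have "\<dots> = lam k powr s * L2_inner \<Omega> ?v (\<phi> k)"
    unfolding frac_op_def by (subst suminf_finite[of "{k}"]) (auto simp: orth)
  finally have "lam k powr (- s) * ?f k = (lam k powr s * lam k powr (- s)) * L2_inner \<Omega> ?v (\<phi> k)"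
    by (simp add: mult_ac)
  then show "L2_inner \<Omega> ?v (\<phi> k) = lam k powr (- s) * ?f k"
    unfolding lam_powr_mult_minus by simp
qed

text \<open>The weights combine to \<open>lam k powr (- s)\<close>, which is at most
  \<open>c powr (- s)\<close>. The hypothesis concerns only coefficients because the lemma is
  applied to a solution minus an element of the approximating space, which need not be a value of
  \<open>frac_inv\<close>.\<close>

lemma frac_norm_le:
  assumes g: "g \<in> L2 \<Omega>" and s: "0 \<le> s"
    and v: "\<And>k. L2_inner \<Omega> v (\<phi> k) = lam k powr (- s) * L2_inner \<Omega> g (\<phi> k)"
  shows "frac_norm \<Omega> lam \<phi> s v \<le> c powr (- s / 2) * L2_norm \<Omega> g"
proof -
  let ?g = "\<lambda>k. L2_inner \<Omega> g (\<phi> k)"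
  have eq: "lam k powr s * (L2_inner \<Omega> v (\<phi> k))\<^sup>2 = lam k powr (- s) * (?g k)\<^sup>2" for k
  proof -
    have "lam k powr s * (L2_inner \<Omega> v (\<phi> k))\<^sup>2
        = (lam k powr s * lam k powr (- s)) * (lam k powr (- s) * (?g k)\<^sup>2)"
      unfolding v by (simp add: power2_eq_square mult_ac)
    then show ?thesis unfolding lam_powr_mult_minus by simp
  qed
  have sg: "(\<lambda>k. c powr (- s) * (?g k)\<^sup>2) sums (c powr (- s) * L2_inner \<Omega> g g)"
    by (intro sums_mult sums_coeff_square g)
  have le: "lam k powr (- s) * (?g k)\<^sup>2 \<le> c powr (- s) * (?g k)\<^sup>2" for k
    using powr_minus_lam_le[OF s] by (rule mult_right_mono) simp
  have sm: "summable (\<lambda>k. lam k powr (- s) * (?g k)\<^sup>2)"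
    by (rule summable_comparison_test'[OF sums_summable[OF sg]]) (use le in simp)
  have "(\<Sum>k. lam k powr s * (L2_inner \<Omega> v (\<phi> k))\<^sup>2) \<le> (\<Sum>k. c powr (- s) * (?g k)\<^sup>2)"
    unfolding eq by (rule suminf_le[OF le sm sums_summable[OF sg]])
  also have "\<dots> = c powr (- s) * L2_inner \<Omega> g g" using sums_unique[OF sg] by simp
  finally have "frac_norm \<Omega> lam \<phi> s v \<le> sqrt (c powr (- s) * L2_inner \<Omega> g g)"
    unfolding frac_norm_def by (rule real_sqrt_le_mono)
  also have "\<dots> = c powr (- s / 2) * L2_norm \<Omega> g"
    using powr_half_sqrt_powr[of c "- s"] c(1) by (simp add: L2_norm_def real_sqrt_mult)
  finally show ?thesis .
qed

section \<open>Subspaces of exact dimension and the width estimate\<close>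

lemma frac_norm_eq_0D:
  assumes "v \<in> frac_space \<Omega> lam \<phi> s" "frac_norm \<Omega> lam \<phi> s v = 0"
  shows "L2_inner \<Omega> v v = 0"
proof -
  have v: "v \<in> L2 \<Omega>" "summable (\<lambda>k. lam k powr s * (L2_inner \<Omega> v (\<phi> k))\<^sup>2)"
    using assms(1) by (auto simp: frac_space_iff)
  have "(\<Sum>k. lam k powr s * (L2_inner \<Omega> v (\<phi> k))\<^sup>2) = 0"
    using assms(2) by (simp add: frac_norm_def)
  then have "\<forall>k. lam k powr s * (L2_inner \<Omega> v (\<phi> k))\<^sup>2 = 0"
    by (subst (asm) suminf_eq_zero_iff[OF v(2)]) auto
  then have "\<forall>k. L2_inner \<Omega> v (\<phi> k) = 0" using lam_pos by (simp add: less_imp_neq[THEN not_sym])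
  then show ?thesis using L2_inner_0_iff[OF v(1)] by blast
qed

text \<open>If every \<open>\<phi> k\<close> with \<open>k \<le> N\<close> were in the span of \<open>e 0, \<dots>, e (N - 1)\<close>, summing the squares of
  all \<open>L2_inner \<Omega> (\<phi> k) (e j)\<close> would give \<open>N + 1\<close> row-wise but at most \<open>N\<close> column-wise (Bessel).\<close>

lemma ex_eigenfunction_outside_span:
  fixes N :: nat
  assumes e: "\<And>i. i < N \<Longrightarrow> e i \<in> L2 \<Omega>"
    and norm: "\<And>i. i < N \<Longrightarrow> L2_inner \<Omega> (e i) (e i) = 1"
  shows "\<exists>k. (\<Sum>j<N. (L2_inner \<Omega> (\<phi> k) (e j))\<^sup>2) \<noteq> 1"
proof (rule ccontr)
  assume "\<not> ?thesis"
  then have "(\<Sum>k<Suc N. \<Sum>j<N. (L2_inner \<Omega> (\<phi> k) (e j))\<^sup>2) = real (Suc N)" by simp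
  moreover have "(\<Sum>k<Suc N. \<Sum>j<N. (L2_inner \<Omega> (\<phi> k) (e j))\<^sup>2) = (\<Sum>j<N. \<Sum>k<Suc N. (L2_inner \<Omega> (\<phi> k) (e j))\<^sup>2)"
    by (rule sum.swap)
  moreover have "\<dots> \<le> (\<Sum>j<N. 1)"
  proof (rule sum_mono)
    fix j assume "j \<in> {..<N}"
    then have j: "(\<lambda>k. (L2_inner \<Omega> (\<phi> k) (e j))\<^sup>2) sums 1"
      using sums_coeff_square[OF e[of j]] norm[of j] by (simp add: L2_inner_commute)
    show "(\<Sum>k<Suc N. (L2_inner \<Omega> (\<phi> k) (e j))\<^sup>2) \<le> 1"
      using sum_le_suminf[OF sums_summable[OF j], of "{..<Suc N}"] sums_unique[OF j] by simp
  qed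
  ultimately show False by simp
qed

text \<open>By Pythagoras the inequality \<open>out\<close> says that the residual of
  \<open>w\<close> after projection onto the span has nonzero norm, so it can be normalised.\<close>

lemma Gram_Schmidt_step:
  fixes N :: nat
  assumes e0: "\<forall>i<N. e i \<in> frac_space \<Omega> lam \<phi> s"
    and on0: "\<forall>i<N. \<forall>j<N. L2_inner \<Omega> (e i) (e j) = (if i = j then 1 else 0)"
    and w: "w \<in> frac_space \<Omega> lam \<phi> s"
    and out: "L2_inner \<Omega> w w \<noteq> (\<Sum>j<N. (L2_inner \<Omega> w (e j))\<^sup>2)"
  shows "\<exists>d r. d \<in> frac_space \<Omega> lam \<phi> s \<and> L2_inner \<Omega> d d = 1 \<and> (\<forall>i<N. L2_inner \<Omega> d (e i) = 0) \<and>
    w = (\<lambda>x. (\<Sum>j<N. L2_inner \<Omega> w (e j) * e j x) + r * d x)"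
proof -
  note e = e0[rule_format] and on = on0[rule_format]
  let ?S = "\<lambda>x. \<Sum>j<N. L2_inner \<Omega> w (e j) * e j x"
  let ?r = "\<lambda>x. w x - ?S x"
  have eL: "e i \<in> L2 \<Omega>" if "i < N" for i using e[OF that] by (simp add: frac_space_iff)
  have wL: "w \<in> L2 \<Omega>" using w by (simp add: frac_space_iff)
  have SL: "?S \<in> L2 \<Omega>" using eL by (intro L2_sum L2_cmult) auto
  have r: "?r \<in> frac_space \<Omega> lam \<phi> s"
    using frac_space_add[OF w frac_space_cmult[OF frac_space_sum, of "{..<N}" "\<lambda>j x. L2_inner \<Omega> w (e j) * e j x" s "-1"]]
      frac_space_cmult e by simp
  have "L2_inner \<Omega> w ?S = (\<Sum>j<N. (L2_inner \<Omega> w (e j))\<^sup>2)"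
    unfolding L2_inner_commute[of \<Omega> w ?S] using eL
    by (subst L2_inner_sum_left[OF wL]) (auto simp: L2_inner_commute[of \<Omega> _ w] power2_eq_square)
  moreover have "L2_inner \<Omega> ?S ?S = (\<Sum>j<N. (L2_inner \<Omega> w (e j))\<^sup>2)"
    using eL on by (intro L2_inner_orthonormal_sum(2)) auto
  ultimately have "L2_inner \<Omega> ?r ?r = L2_inner \<Omega> w w - (\<Sum>j<N. (L2_inner \<Omega> w (e j))\<^sup>2)"
    using L2_inner_diff_self[OF wL SL] by simp
  then have rn: "L2_norm \<Omega> ?r \<noteq> 0" using out by (simp add: L2_norm_def)
  let ?d = "\<lambda>x. (1 / L2_norm \<Omega> ?r) * ?r x"
  have "?d \<in> frac_space \<Omega> lam \<phi> s" by (rule frac_space_cmult[OF r])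
  moreover have "L2_inner \<Omega> ?d ?d = 1"
    unfolding L2_inner_cmult_left L2_inner_cmult_right L2_norm_sq[symmetric]
    using rn by (simp add: power2_eq_square)
  moreover have "L2_inner \<Omega> ?d (e i) = 0" if "i < N" for i
  proof -
    have "L2_inner \<Omega> ?S (e i) = L2_inner \<Omega> w (e i)"
      using eL on that by (intro L2_inner_orthonormal_sum(1)) auto
    then have "L2_inner \<Omega> ?r (e i) = 0" using L2_inner_diff_left[OF wL SL eL[OF that]] by simp
    then show ?thesis unfolding L2_inner_cmult_left by simp
  qed
  moreover have "w = (\<lambda>x. ?S x + L2_norm \<Omega> ?r * ?d x)" using rn by (simp add: fun_eq_iff)
  ultimately show ?thesis by (intro exI[of _ ?d] exI[of _ "L2_norm \<Omega> ?r"] conjI) auto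
qed

text \<open>Supplies exactly \<open>N\<close> orthonormal elements even if the \<open>u i\<close>
  are dependent. The spanning property is stated for coefficients, since the combinations represent
  the \<open>u i\<close> only up to null functions.\<close>

lemma ex_orthonormal_family_spanning:
  fixes N :: nat
  assumes u: "\<And>i. u i \<in> frac_space \<Omega> lam \<phi> s"
  shows "\<exists>e. (\<forall>i<N. e i \<in> frac_space \<Omega> lam \<phi> s) \<and>
    (\<forall>i<N. \<forall>j<N. L2_inner \<Omega> (e i) (e j) = (if i = j then 1 else 0)) \<and>
    (\<forall>i<N. \<exists>a. \<forall>m. L2_inner \<Omega> (u i) (\<phi> m) = (\<Sum>j<N. a j * L2_inner \<Omega> (e j) (\<phi> m)))"
proof (induction N)
  case 0
  show ?case by simp
next
  case (Suc N)
  then obtain e where e0: "\<forall>i<N. e i \<in> frac_space \<Omega> lam \<phi> s"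
    and on0: "\<forall>i<N. \<forall>j<N. L2_inner \<Omega> (e i) (e j) = (if i = j then 1 else 0)"
    and sp: "\<forall>i<N. \<exists>a. \<forall>m. L2_inner \<Omega> (u i) (\<phi> m) = (\<Sum>j<N. a j * L2_inner \<Omega> (e j) (\<phi> m))"
    by (elim exE conjE)
  note e = e0[rule_format] and on = on0[rule_format]
  have eL: "e i \<in> L2 \<Omega>" if "i < N" for i using e[OF that] by (simp add: frac_space_iff)
  have uL: "u N \<in> L2 \<Omega>" using u[of N] by (simp add: frac_space_iff)
  let ?S = "\<lambda>x. \<Sum>j<N. L2_inner \<Omega> (u N) (e j) * e j x"
  have SL: "?S \<in> L2 \<Omega>" using eL by (intro L2_sum L2_cmult) auto
  have S\<phi>: "L2_inner \<Omega> ?S (\<phi> m) = (\<Sum>j<N. L2_inner \<Omega> (u N) (e j) * L2_inner \<Omega> (e j) (\<phi> m))" for m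
    using eL by (intro L2_inner_sum_left \<phi>) auto
  have "\<exists>d. d \<in> frac_space \<Omega> lam \<phi> s \<and> L2_inner \<Omega> d d = 1 \<and> (\<forall>i<N. L2_inner \<Omega> d (e i) = 0) \<and>
    (\<exists>a r. \<forall>m. L2_inner \<Omega> (u N) (\<phi> m) = (\<Sum>j<N. a j * L2_inner \<Omega> (e j) (\<phi> m)) + r * L2_inner \<Omega> d (\<phi> m))"
  proof (cases "L2_inner \<Omega> (u N) (u N) = (\<Sum>j<N. (L2_inner \<Omega> (u N) (e j))\<^sup>2)")
    case True
    \<comment> \<open>Here \<open>u N\<close> lies in the span modulo null functions, but its slot
      must still be filled: the normalised residual of an eigenfunction outside the span takes it
      and enters \<open>u N\<close> with factor 0.\<close>
    have "\<exists>k. (\<Sum>j<N. (L2_inner \<Omega> (\<phi> k) (e j))\<^sup>2) \<noteq> 1"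
      by (rule ex_eigenfunction_outside_span) (simp_all add: eL on)
    then obtain k where "(\<Sum>j<N. (L2_inner \<Omega> (\<phi> k) (e j))\<^sup>2) \<noteq> 1" by (elim exE)
    then have "1 \<noteq> (\<Sum>j<N. (L2_inner \<Omega> (\<phi> k) (e j))\<^sup>2)" by (rule not_sym)
    then have "L2_inner \<Omega> (\<phi> k) (\<phi> k) \<noteq> (\<Sum>j<N. (L2_inner \<Omega> (\<phi> k) (e j))\<^sup>2)"
      by (simp add: orth)
    from Gram_Schmidt_step[OF e0 on0 eigenfunction_in_frac_space this]
    obtain d where d: "d \<in> frac_space \<Omega> lam \<phi> s" "L2_inner \<Omega> d d = 1" "\<forall>i<N. L2_inner \<Omega> d (e i) = 0"
      by (elim exE conjE)
    have "L2_inner \<Omega> (u N) ?S = (\<Sum>j<N. (L2_inner \<Omega> (u N) (e j))\<^sup>2)"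
      unfolding L2_inner_commute[of \<Omega> "u N" ?S] using eL
      by (subst L2_inner_sum_left[OF uL]) (auto simp: L2_inner_commute[of \<Omega> _ "u N"] power2_eq_square)
    moreover have "L2_inner \<Omega> ?S ?S = (\<Sum>j<N. (L2_inner \<Omega> (u N) (e j))\<^sup>2)"
      using eL on by (intro L2_inner_orthonormal_sum(2)) auto
    ultimately have "L2_inner \<Omega> (\<lambda>x. u N x - ?S x) (\<lambda>x. u N x - ?S x) = 0"
      using L2_inner_diff_self[OF uL SL] True by simp
    then have "L2_inner \<Omega> (u N) (\<phi> m) = (\<Sum>j<N. L2_inner \<Omega> (u N) (e j) * L2_inner \<Omega> (e j) (\<phi> m)) + 0 * L2_inner \<Omega> d (\<phi> m)" for m
      using L2_inner_0_iff[OF L2_diff[OF uL SL]] L2_inner_diff_left[OF uL SL \<phi>[of m]] S\<phi>[of m] by simp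
    then have "\<exists>a r. \<forall>m. L2_inner \<Omega> (u N) (\<phi> m) = (\<Sum>j<N. a j * L2_inner \<Omega> (e j) (\<phi> m)) + r * L2_inner \<Omega> d (\<phi> m)"
      by (intro exI[of _ "\<lambda>j. L2_inner \<Omega> (u N) (e j)"] exI[of _ "0"] allI)
    then show ?thesis using d by (intro exI[of _ d] conjI)
  next
    case False
    from Gram_Schmidt_step[OF e0 on0 u[of N] False]
    obtain d r where d: "d \<in> frac_space \<Omega> lam \<phi> s" "L2_inner \<Omega> d d = 1" "\<forall>i<N. L2_inner \<Omega> d (e i) = 0"
      and uN: "u N = (\<lambda>x. ?S x + r * d x)"
      by (elim exE conjE)
    have dL: "d \<in> L2 \<Omega>" using d(1) by (simp add: frac_space_iff)
    have "L2_inner \<Omega> (u N) (\<phi> m) = L2_inner \<Omega> (\<lambda>x. ?S x + r * d x) (\<phi> m)" for m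
      using uN by (rule arg_cong)
    also have "L2_inner \<Omega> (\<lambda>x. ?S x + r * d x) (\<phi> m)
        = (\<Sum>j<N. L2_inner \<Omega> (u N) (e j) * L2_inner \<Omega> (e j) (\<phi> m)) + r * L2_inner \<Omega> d (\<phi> m)" for m
      unfolding L2_inner_add_left[OF SL L2_cmult[OF dL] \<phi>] S\<phi> L2_inner_cmult_left ..
    finally have "L2_inner \<Omega> (u N) (\<phi> m)
        = (\<Sum>j<N. L2_inner \<Omega> (u N) (e j) * L2_inner \<Omega> (e j) (\<phi> m)) + r * L2_inner \<Omega> d (\<phi> m)" for m .
    then have "\<exists>a r. \<forall>m. L2_inner \<Omega> (u N) (\<phi> m) = (\<Sum>j<N. a j * L2_inner \<Omega> (e j) (\<phi> m)) + r * L2_inner \<Omega> d (\<phi> m)"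
      by (intro exI[of _ "\<lambda>j. L2_inner \<Omega> (u N) (e j)"] exI[of _ "r"] allI)
    then show ?thesis using d by (intro exI[of _ d] conjI)
  qed
  then obtain d a r where d: "d \<in> frac_space \<Omega> lam \<phi> s" "L2_inner \<Omega> d d = 1" "\<forall>i<N. L2_inner \<Omega> d (e i) = 0"
    and uN: "\<And>m. L2_inner \<Omega> (u N) (\<phi> m) = (\<Sum>j<N. a j * L2_inner \<Omega> (e j) (\<phi> m)) + r * L2_inner \<Omega> d (\<phi> m)"
    by (elim exE conjE) (rule that, auto)
  define e' where "e' = e(N := d)"
  have e'N: "e' N = d" "\<And>i. i < N \<Longrightarrow> e' i = e i" by (simp_all add: e'_def)
  show ?case
  proof (intro exI[of _ e'] conjI allI impI)
    show "e' i \<in> frac_space \<Omega> lam \<phi> s" if "i < Suc N" for i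
      using that e d(1) e'N by (cases "i = N") auto
    show "L2_inner \<Omega> (e' i) (e' j) = (if i = j then 1 else 0)" if "i < Suc N" "j < Suc N" for i j
    proof -
      have "L2_inner \<Omega> (e i) d = 0" if "i < N" for i
        by (subst L2_inner_commute) (use d(3) that in simp)
      then show ?thesis using that on d(2,3) e'N by (cases "i = N"; cases "j = N") simp_all
    qed
    show "\<exists>a. \<forall>m. L2_inner \<Omega> (u i) (\<phi> m) = (\<Sum>j<Suc N. a j * L2_inner \<Omega> (e' j) (\<phi> m))" if "i < Suc N" for i
    proof (cases "i = N")
      case True
      show ?thesis by (intro exI[of _ "a(N := r)"]) (simp add: True uN e'N)
    next
      case False
      then have "i < N" using that by simp
      from sp[rule_format, OF this]
      obtain a where "\<forall>m. L2_inner \<Omega> (u i) (\<phi> m) = (\<Sum>j<N. a j * L2_inner \<Omega> (e j) (\<phi> m))"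
        by (elim exE)
      then show ?thesis by (intro exI[of _ "a(N := 0)"]) (simp add: e'N)
    qed
  qed
qed

text \<open>The inverse power carries an approximation of the data to one of the solutions, losing
  only the factor \<open>c powr (- s / 2)\<close>. The sequence \<open>q\<close> is infinite, so
  \<open>N\<close> of its terms can be used to span the space, and \<open>m \<le> N\<close> places
  the functions that approximate \<open>K\<close> among them.\<close>

lemma kolmogorov_width_frac_inv_le:
  assumes s: "0 < s" and q: "\<And>k. q k \<in> L2 \<Omega>" and mN: "m \<le> N" and K: "K \<subseteq> L2 \<Omega>"
    and approx: "\<And>f. f \<in> K \<Longrightarrow> \<exists>a. L2_norm \<Omega> (\<lambda>x. f x - (\<Sum>k<m. a k * q k x)) \<le> \<delta>"
  shows "kolmogorov_width N (frac_inv \<Omega> lam \<phi> s ` K) (frac_space \<Omega> lam \<phi> s) (frac_norm \<Omega> lam \<phi> s)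
    \<le> ennreal (c powr (- s / 2) * \<delta>)"
proof -
  let ?T = "frac_inv \<Omega> lam \<phi> s"
  from ex_orthonormal_family_spanning[of "\<lambda>i. ?T (q i)" s N, OF frac_inv_coeff(1)[OF q s]]
  obtain e where e0: "\<forall>i<N. e i \<in> frac_space \<Omega> lam \<phi> s"
    and on0: "\<forall>i<N. \<forall>j<N. L2_inner \<Omega> (e i) (e j) = (if i = j then 1 else 0)"
    and sp: "\<forall>i<N. \<exists>a. \<forall>m. L2_inner \<Omega> (?T (q i)) (\<phi> m) = (\<Sum>j<N. a j * L2_inner \<Omega> (e j) (\<phi> m))"
    by (elim exE conjE)
  note e = e0[rule_format] and on = on0[rule_format]
  have eL: "e i \<in> L2 \<Omega>" if "i < N" for i using e[OF that] by (simp add: frac_space_iff)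
  have "\<forall>i. \<exists>a. i < N \<longrightarrow> (\<forall>m. L2_inner \<Omega> (?T (q i)) (\<phi> m) = (\<Sum>j<N. a j * L2_inner \<Omega> (e j) (\<phi> m)))"
    using sp by blast
  from choice[OF this] obtain b where
    b: "\<forall>i. i < N \<longrightarrow> (\<forall>m. L2_inner \<Omega> (?T (q i)) (\<phi> m) = (\<Sum>j<N. b i j * L2_inner \<Omega> (e j) (\<phi> m)))"
    by (elim exE)
  define E where "E = range (\<lambda>a :: nat \<Rightarrow> real. \<lambda>x. \<Sum>i<N. a i * e i x)"
  have "E \<in> subspaces_of_dim (frac_space \<Omega> lam \<phi> s) (frac_norm \<Omega> lam \<phi> s) N"
    unfolding subspaces_of_dim_def mem_Collect_eq
  proof (intro exI[of _ e] conjI allI impI)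
    fix a :: "nat \<Rightarrow> real" and i
    assume z: "frac_norm \<Omega> lam \<phi> s (\<lambda>x. \<Sum>i<N. a i * e i x) = 0" and i: "i < N"
    have "(\<lambda>x. \<Sum>i<N. a i * e i x) \<in> frac_space \<Omega> lam \<phi> s"
      using e by (intro frac_space_sum frac_space_cmult) auto
    then have "L2_inner \<Omega> (\<lambda>x. \<Sum>i<N. a i * e i x) (\<lambda>x. \<Sum>i<N. a i * e i x) = 0"
      using z by (rule frac_norm_eq_0D)
    moreover have "L2_inner \<Omega> (\<lambda>x. \<Sum>i<N. a i * e i x) (\<lambda>x. \<Sum>i<N. a i * e i x) = (\<Sum>i<N. (a i)\<^sup>2)"
      using eL on by (intro L2_inner_orthonormal_sum(2)) auto
    ultimately have "(\<Sum>i<N. (a i)\<^sup>2) = 0" by simp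
    then show "a i = 0" using i by (simp add: sum_nonneg_eq_0_iff)
  qed (simp_all add: e E_def)
  then have "kolmogorov_width N (?T ` K) (frac_space \<Omega> lam \<phi> s) (frac_norm \<Omega> lam \<phi> s)
      \<le> (SUP v\<in>?T ` K. INF g\<in>E. ennreal (frac_norm \<Omega> lam \<phi> s (\<lambda>x. v x - g x)))"
    unfolding kolmogorov_width_def by (rule INF_lower)
  also have "\<dots> \<le> ennreal (c powr (- s / 2) * \<delta>)"
  proof (rule SUP_least)
    fix v assume "v \<in> ?T ` K"
    then obtain f where f: "f \<in> K" and v: "v = ?T f" by (rule imageE)
    obtain a where a: "L2_norm \<Omega> (\<lambda>x. f x - (\<Sum>k<m. a k * q k x)) \<le> \<delta>" using approx[OF f] ..
    let ?p = "\<lambda>x. \<Sum>k<m. a k * q k x" and ?g = "\<lambda>x. \<Sum>j<N. (\<Sum>k<m. a k * b k j) * e j x"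
    have "f \<in> L2 \<Omega>" "?T f \<in> L2 \<Omega>"
      using f K frac_inv_coeff(1)[of f s] s by (auto simp: frac_space_iff)
    moreover have "?p \<in> L2 \<Omega>" "?g \<in> L2 \<Omega>" by (intro L2_sum L2_cmult q eL; simp)+
    ultimately have L: "f \<in> L2 \<Omega>" "?T f \<in> L2 \<Omega>" "?p \<in> L2 \<Omega>" "?g \<in> L2 \<Omega>" .
    \<comment> \<open>Linearity of the inverse power, expressed on coefficients: \<open>?g\<close>
      has those of the solution with datum \<open>?p\<close>.\<close>
    have "L2_inner \<Omega> (\<lambda>x. ?T f x - ?g x) (\<phi> l) = lam l powr (- s) * L2_inner \<Omega> (\<lambda>x. f x - ?p x) (\<phi> l)" for l
    proof -
      have "L2_inner \<Omega> ?g (\<phi> l) = (\<Sum>j<N. (\<Sum>k<m. a k * b k j) * L2_inner \<Omega> (e j) (\<phi> l))"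
        using eL by (intro L2_inner_sum_left \<phi>) auto
      also have "\<dots> = (\<Sum>k<m. a k * (\<Sum>j<N. b k j * L2_inner \<Omega> (e j) (\<phi> l)))"
        unfolding sum_distrib_left sum_distrib_right mult.assoc by (rule sum.swap)
      also have "\<dots> = (\<Sum>k<m. a k * (lam l powr (- s) * L2_inner \<Omega> (q k) (\<phi> l)))"
        using b mN frac_inv_coeff(2)[OF q s] by (intro sum.cong) auto
      also have "\<dots> = lam l powr (- s) * L2_inner \<Omega> ?p (\<phi> l)"
        unfolding L2_inner_sum_left[OF \<phi> q] by (simp add: sum_distrib_left mult_ac)
      finally show ?thesis
        unfolding L2_inner_diff_left[OF L(2,4) \<phi>] L2_inner_diff_left[OF L(1,3) \<phi>] frac_inv_coeff(2)[OF L(1) s]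
        by (simp add: right_diff_distrib)
    qed
    then have "frac_norm \<Omega> lam \<phi> s (\<lambda>x. ?T f x - ?g x) \<le> c powr (- s / 2) * L2_norm \<Omega> (\<lambda>x. f x - ?p x)"
      using s by (intro frac_norm_le L2_diff L) auto
    also have "\<dots> \<le> c powr (- s / 2) * \<delta>" using a by (intro mult_left_mono) auto
    finally have le: "ennreal (frac_norm \<Omega> lam \<phi> s (\<lambda>x. v x - ?g x)) \<le> ennreal (c powr (- s / 2) * \<delta>)"
      unfolding v by (rule ennreal_leI)
    have "?g \<in> E"
      unfolding E_def by (rule range_eqI[of _ _ "\<lambda>j. \<Sum>k<m. a k * b k j"]) (rule refl)
    then show "(INF g\<in>E. ennreal (frac_norm \<Omega> lam \<phi> s (\<lambda>x. v x - g x))) \<le> ennreal (c powr (- s / 2) * \<delta>)"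
      by (rule INF_lower2) (rule le)
  qed
  finally show ?thesis .
qed

end

text \<open>The largest admissible degree is \<open>t = sqrt (N / M)\<close> rounded down; rounding
  loses less than 1 in the exponent of 1/2, hence the factor 2. For \<open>N < M\<close> the degree
  is 0.\<close>

lemma ex_degree_exponential:
  fixes M N :: nat
  assumes "0 < M" "1 \<le> N"
  shows "\<exists>p. M * p\<^sup>2 \<le> N \<and> (1/2) ^ p \<le> 2 * exp (- (ln 2 / sqrt (real M)) * real N powr (1/4))"
proof -
  define t where "t = sqrt (real N / real M)"
  have t0: "0 \<le> t" by (simp add: t_def)
  define p where "p = nat \<lfloor>t\<rfloor>"
  have p: "real p \<le> t" "t \<le> real p + 1" using t0 by (simp_all add: p_def)
  have "(real p)\<^sup>2 \<le> t\<^sup>2" using p(1) by (intro power_mono) auto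
  then have "real M * (real p)\<^sup>2 \<le> real N" using assms(1) by (simp add: t_def field_simps)
  then have 1: "M * p\<^sup>2 \<le> N" by (metis of_nat_le_iff of_nat_mult of_nat_power)
  \<comment> \<open>At this point the square-root rate is weakened to the fourth root, using
    \<open>1 \<le> N\<close>.\<close>
  have "real N powr (1/4) \<le> real N powr (1/2)" using assms(2) by (intro powr_mono) auto
  then have "real N powr (1/4) / sqrt (real M) \<le> t"
    using assms by (simp add: t_def powr_half_sqrt real_sqrt_divide divide_right_mono)
  then have "ln 2 * (real N powr (1/4) / sqrt (real M)) \<le> ln 2 * (real p + 1)"
    using p(2) by (intro mult_left_mono) auto
  then have "exp (- (ln 2 * (real p + 1))) \<le> exp (- (ln 2 / sqrt (real M)) * real N powr (1/4))"
    by simp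
  moreover have "exp (ln 2 * (real p + 1)) = 2 * 2 ^ p"
    by (simp add: distrib_left exp_add mult.commute[of "ln 2"] exp_of_nat_mult)
  then have "exp (- (ln 2 * (real p + 1))) = (1/2) ^ p / 2"
    by (simp only: exp_minus) (simp add: power_divide field_simps)
  ultimately show ?thesis using 1 by (intro exI[of _ p]) simp
qed

theorem mainTheorem5:
  fixes \<Omega> :: "(real^2) set" and J :: nat and s :: real
    and A :: "real^2 \<Rightarrow> real^2^2" and G :: "(complex^2) set"
    and lam :: "nat \<Rightarrow> real" and \<phi> :: "nat \<Rightarrow> real^2 \<Rightarrow> real"
  assumes "curvilinear_polygon J \<Omega>"
    and "0 < s" "s < 1"
    and "analytic_coefficient \<Omega> A"
    and "\<forall>x\<in>\<Omega>. transpose (A x) = A x"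
    and "uniformly_positive_definite \<Omega> A"
    and "dirichlet_eigenbasis \<Omega> A lam \<phi>"
    and "open G" "of_real2 ` closure \<Omega> \<subseteq> G"
  shows "\<exists>C>0. \<exists>b>0. \<forall>N::nat. N \<ge> 1 \<longrightarrow>
    kolmogorov_width N (frac_inv \<Omega> lam \<phi> s ` analytic_data \<Omega> G)
        (frac_space \<Omega> lam \<phi> s) (frac_norm \<Omega> lam \<phi> s)
      \<le> ennreal (C * exp (- b * real N powr (1/4)))"
proof -
  have dom: "open \<Omega>" "bounded \<Omega>" "\<Omega> \<noteq> {}"
    using assms(1) by (auto simp: curvilinear_polygon_def bounded_Lipschitz_domain_def)
  obtain c where c: "c > 0" "\<And>k. c \<le> lam k"
    using dirichlet_eigenvalues_bounded_below[OF dom(1,2) assms(4,6,7)] by auto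
  interpret spectral_basis \<Omega> lam \<phi> c
  proof
    show "\<Omega> \<in> lmeasurable" using dom by (intro lmeasurable_open)
  qed (use assms(7) c in \<open>auto simp: dirichlet_eigenbasis_def H10_def H1_def\<close>)
  obtain M where M: "M > 0" and q: "\<And>p. \<exists>q. (\<forall>k. q k \<in> L2 \<Omega>) \<and> (\<forall>f\<in>analytic_data \<Omega> G. \<exists>a.
    L2_norm \<Omega> (\<lambda>x. f x - (\<Sum>k<M * p\<^sup>2. a k * q k x)) \<le> 6 * (1/2) ^ p * sqrt (measure lebesgue \<Omega>))"
    using analytic_data_approximation[OF dom assms(8,9)] by auto
  \<comment> \<open>Collects the factor 6 of the local approximation, the bound
    \<open>c powr (- s / 2)\<close> for the inverse power, and the root of the measure that turns a
    uniform error into an \<open>L2\<close> error.\<close>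
  define B where "B = 6 * c powr (- s / 2) * sqrt (measure lebesgue \<Omega>)"
  have B0: "B \<ge> 0" by (simp add: B_def)
  define b where "b = ln 2 / sqrt (real M)"
  \<comment> \<open>The factor 2 comes from rounding the degree; adding 1 makes the constant
    positive, as \<open>B\<close> is only known to be nonnegative.\<close>
  have "kolmogorov_width N (frac_inv \<Omega> lam \<phi> s ` analytic_data \<Omega> G) (frac_space \<Omega> lam \<phi> s) (frac_norm \<Omega> lam \<phi> s)
      \<le> ennreal ((2 * B + 1) * exp (- b * real N powr (1/4)))" if N: "N \<ge> 1" for N :: nat
  proof -
    obtain p where p: "M * p\<^sup>2 \<le> N" "(1/2) ^ p \<le> 2 * exp (- b * real N powr (1/4))"
      using ex_degree_exponential[OF M N] unfolding b_def by auto
    obtain q where q: "\<And>k. q k \<in> L2 \<Omega>" "\<And>f. f \<in> analytic_data \<Omega> G \<Longrightarrow> \<exists>a.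
      L2_norm \<Omega> (\<lambda>x. f x - (\<Sum>k<M * p\<^sup>2. a k * q k x)) \<le> 6 * (1/2) ^ p * sqrt (measure lebesgue \<Omega>)"
      using q[of p] by auto
    have "kolmogorov_width N (frac_inv \<Omega> lam \<phi> s ` analytic_data \<Omega> G) (frac_space \<Omega> lam \<phi> s) (frac_norm \<Omega> lam \<phi> s)
      \<le> ennreal (c powr (- s / 2) * (6 * (1/2) ^ p * sqrt (measure lebesgue \<Omega>)))"
      by (rule kolmogorov_width_frac_inv_le[OF assms(2) q(1) p(1) _ q(2)]) (auto simp: analytic_data_def)
    also have "c powr (- s / 2) * (6 * (1/2) ^ p * sqrt (measure lebesgue \<Omega>)) = B * (1/2) ^ p"
      by (simp add: B_def)
    also have "B * (1/2) ^ p \<le> B * (2 * exp (- b * real N powr (1/4)))"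
      using p(2) B0 by (rule mult_left_mono)
    also have "\<dots> \<le> (2 * B + 1) * exp (- b * real N powr (1/4))" by (simp add: algebra_simps)
    finally show ?thesis by (simp add: ennreal_leI)
  qed
  moreover have "b > 0" using M by (simp add: b_def)
  ultimately show ?thesis using B0 by (intro exI[of _ "2 * B + 1"] exI[of _ b] conjI) auto
qed

end
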